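(* For the Gaussian state-dependent multiaccess channel described in the context, the capacity region $\mathcal C_G$ is contained in the union, over all $\rho_{12}\in[0,1]$ and $\rho_{2s}\in[-1,0]$ with $\rho_{12}^2+\rho_{2s}^2\le1$, of the set of rate pairs $(R_c,R_1)$ satisfying $$R_1\le\tfrac12\log\Big(1+\frac{P_1(1-\rho_{12}^2-\rho_{2s}^2)}{N(1-\rho_{2s}^2)}\Big),$$ $$R_c+R_1\le\tfrac12\log\Big(1+\frac{(\sqrt{P_1}+\rho_{12}\sqrt{P_2})^2}{P_2(1-\rho_{12}^2-\rho_{2s}^2)+(\sqrt Q+\rho_{2s}\sqrt{P_2})^2+N}\Big)+\tfrac12\log\Big(1+\frac{P_2(1-\rho_{12}^2-\rho_{2s}^2)}{N}\Big),$$ where, when $\rho_{2s}=-1$ (so $\rho_{12}=0$), the ratio $\frac{1-\rho_{12}^2-\rho_{2s}^2}{1-\rho_{2s}^2}$ is interpreted as $1$.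
   Context: Gaussian model: at each time $i$, $Y_i=X_{1,i}+X_{2,i}+S_i+Z_i$, where $S_i\sim\mathcal N(0,Q)$ (state) and $Z_i\sim\mathcal N(0,N)$ (noise), all $S_i,Z_i$ mutually independent across time and of each other, and independent of the messages; $Q,N>0$. Two independent uniformly distributed messages: a common message $W_c$ of rate $R_c$ and an individual message $W_1$ of rate $R_1$. The uninformed encoder maps $(W_c,W_1)$ to $X_1^n$; the informed encoder knows the entire state sequence $S^n$ non-causally and maps $(S^n,W_c)$ to $X_2^n$; the decoder, which does not know the state, maps $Y^n$ to an estimate of $(W_c,W_1)$. Power constraints: $\sum_{i=1}^n X_{1,i}^2\le nP_1$ and $\sum_{i=1}^n X_{2,i}^2\le nP_2$. A rate pair is achievable if there are codes satisfying these constraints whose probability of decoding error $\Pr[\psi^n(Y^n)\neq (W_c,W_1)]$ tends to $0$ as $n\to\infty$; $\mathcal C_G$ is the closure of the set of achievable pairs. *)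

theory Defs
  imports "HOL-Probability.Probability"
begin

text \<open>Sequences of length n are functions nat => real, only indices < n matter.
  iid_gauss v n: law of n i.i.d. N(0,v) samples (extensional functions on {..<n}).\<close>

definition iid_gauss :: "real \<Rightarrow> nat \<Rightarrow> (nat \<Rightarrow> real) measure" where
  "iid_gauss v n = PiM {..<n} (\<lambda>_. density lborel (normal_density 0 (sqrt v)))"

definition chan_out :: "nat \<Rightarrow> (nat \<Rightarrow> real) \<Rightarrow> (nat \<Rightarrow> real) \<Rightarrow> (nat \<Rightarrow> real)
    \<Rightarrow> (nat \<Rightarrow> real) \<Rightarrow> (nat \<Rightarrow> real)" where
  "chan_out n x1 x2 s z = (\<lambda>i\<in>{..<n}. x1 i + x2 i + s i + z i)"

text \<open>A code of length n with Mc common and M1 individual messages (messages are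
  {..<Mc} and {..<M1}): uninformed encoder f1 wc w1, informed encoder f2 s wc
  (s is the whole state sequence), decoder dec.  Power constraints and
  measurability (needed for the error probability to be defined).\<close>
definition is_code :: "real \<Rightarrow> real \<Rightarrow> real \<Rightarrow> nat \<Rightarrow> nat \<Rightarrow> nat
    \<Rightarrow> (nat \<Rightarrow> nat \<Rightarrow> nat \<Rightarrow> real) \<Rightarrow> ((nat \<Rightarrow> real) \<Rightarrow> nat \<Rightarrow> nat \<Rightarrow> real)
    \<Rightarrow> ((nat \<Rightarrow> real) \<Rightarrow> nat \<times> nat) \<Rightarrow> bool" where
  "is_code Q P1 P2 n Mc M1 f1 f2 dec \<longleftrightarrow>
     (\<forall>wc<Mc. \<forall>w1<M1. (\<Sum>i<n. (f1 wc w1 i)\<^sup>2) \<le> real n * P1) \<and>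
     (\<forall>s\<in>space (iid_gauss Q n). \<forall>wc<Mc. (\<Sum>i<n. (f2 s wc i)\<^sup>2) \<le> real n * P2) \<and>
     (\<forall>wc<Mc. \<forall>i<n. (\<lambda>s. f2 s wc i) \<in> borel_measurable (iid_gauss Q n)) \<and>
     dec \<in> measurable (PiM {..<n} (\<lambda>_. borel)) (count_space UNIV)"

definition err_prob :: "real \<Rightarrow> real \<Rightarrow> nat \<Rightarrow> nat \<Rightarrow> nat
    \<Rightarrow> (nat \<Rightarrow> nat \<Rightarrow> nat \<Rightarrow> real) \<Rightarrow> ((nat \<Rightarrow> real) \<Rightarrow> nat \<Rightarrow> nat \<Rightarrow> real)
    \<Rightarrow> ((nat \<Rightarrow> real) \<Rightarrow> nat \<times> nat) \<Rightarrow> real" where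
  "err_prob Q N n Mc M1 f1 f2 dec =
     (\<Sum>wc<Mc. \<Sum>w1<M1.
        measure (iid_gauss Q n \<Otimes>\<^sub>M iid_gauss N n)
          {sz \<in> space (iid_gauss Q n \<Otimes>\<^sub>M iid_gauss N n).
             dec (chan_out n (f1 wc w1) (f2 (fst sz) wc) (fst sz) (snd sz)) \<noteq> (wc, w1)})
     / (real Mc * real M1)"

definition achievable :: "real \<Rightarrow> real \<Rightarrow> real \<Rightarrow> real \<Rightarrow> real \<times> real \<Rightarrow> bool" where
  "achievable Q N P1 P2 r \<longleftrightarrow>
     0 \<le> fst r \<and> 0 \<le> snd r \<and>
     (\<exists>Mc M1 f1 f2 dec.
        (\<forall>n. real (Mc n) \<ge> 2 powr (real n * fst r) \<and> real (M1 n) \<ge> 2 powr (real n * snd r) \<and>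
             is_code Q P1 P2 n (Mc n) (M1 n) (f1 n) (f2 n) (dec n)) \<and>
        (\<lambda>n. err_prob Q N n (Mc n) (M1 n) (f1 n) (f2 n) (dec n)) \<longlonglongrightarrow> 0)"

definition capacity_region :: "real \<Rightarrow> real \<Rightarrow> real \<Rightarrow> real \<Rightarrow> (real \<times> real) set" where
  "capacity_region Q N P1 P2 = closure {r. achievable Q N P1 P2 r}"

definition ratio_term :: "real \<Rightarrow> real \<Rightarrow> real" where
  "ratio_term r12 r2s = (if r2s = -1 then 1 else (1 - r12\<^sup>2 - r2s\<^sup>2) / (1 - r2s\<^sup>2))"

definition outer_region :: "real \<Rightarrow> real \<Rightarrow> real \<Rightarrow> real \<Rightarrow> (real \<times> real) set" where
  "outer_region Q N P1 P2 =
     (\<Union>r12\<in>{0..1}. \<Union>r2s\<in>{-1..0}. if r12\<^sup>2 + r2s\<^sup>2 \<le> 1 then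
        {(Rc, R1). R1 \<le> 1/2 * log 2 (1 + P1 * ratio_term r12 r2s / N) \<and>
           Rc + R1 \<le> 1/2 * log 2 (1 + (sqrt P1 + r12 * sqrt P2)\<^sup>2 /
                         (P2 * (1 - r12\<^sup>2 - r2s\<^sup>2) + (sqrt Q + r2s * sqrt P2)\<^sup>2 + N))
                     + 1/2 * log 2 (1 + P2 * (1 - r12\<^sup>2 - r2s\<^sup>2) / N)}
      else {})"

end

theory Submission
  imports Defs
begin

text \<open>
  Both rate bounds come from comparing, under the decoding event, the true law of messages, state
  and output with an alternative law under which decoding is no better than guessing:
  Donsker-Varadhan with the test function ln M on correct decoding bounds (1 - err) ln M by the
  relative entropy plus ln 2.

  For the sum rate the alternative makes Y i.i.d. Gaussian and independent of the messages, and S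
  given Y and the messages Gaussian around a Y + b X1; averaging out S replaces a lower bound on the
  entropy of Y given the messages, whose law is a mixture. For R1 the alternative makes Y Gaussian
  given S and the common message, around X2 + S plus a linear estimate of X1 from X2 and S.
  Because the coefficients and variances are the same at all times, the log-likelihood ratios are
  quadratic and their means depend only on second moments averaged over messages and time.

  Estimators tuned to the covariance with the full powers P1 and P2 turn these into the stated
  bounds, where r12 and r2s are the averaged correlations with favourable signs. Finally the outer
  region is closed, so the terms err and 1/n disappear in the limit.
\<close>

subsection \<open>Gaussian product measures\<close>

text \<open>Finite products of measures are determined by boxes, and on a box both the density and
  the indicator factorise, so the integral splits coordinatewise.\<close>

lemma PiM_density:
  assumes "finite I" and M: "product_sigma_finite M"
    and D: "product_sigma_finite (\<lambda>i. density (M i) (f i))"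
    and f: "\<And>i. i \<in> I \<Longrightarrow> f i \<in> borel_measurable (M i)"
  shows "PiM I (\<lambda>i. density (M i) (f i)) = density (PiM I M) (\<lambda>x. \<Prod>i\<in>I. f i (x i))"
proof -
  interpret M: product_sigma_finite M by fact
  interpret D: product_sigma_finite "\<lambda>i. density (M i) (f i)" by fact
  note f[measurable]
  have mprod[measurable]: "(\<lambda>x. \<Prod>i\<in>I. f i (x i)) \<in> borel_measurable (PiM I M)"
    by measurable
  show ?thesis
  proof (rule D.PiM_eqI[symmetric])
    show "sets (density (PiM I M) (\<lambda>x. \<Prod>i\<in>I. f i (x i))) = sets (PiM I (\<lambda>i. density (M i) (f i)))"
      by (auto intro!: sets_PiM_cong)
    fix A assume A: "\<And>i. i \<in> I \<Longrightarrow> A i \<in> sets (density (M i) (f i))"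
    then have A'[measurable]: "\<And>i. i \<in> I \<Longrightarrow> A i \<in> sets (M i)" by simp
    have "emeasure (density (PiM I M) (\<lambda>x. \<Prod>i\<in>I. f i (x i))) (Pi\<^sub>E I A)
      = (\<integral>\<^sup>+x. (\<Prod>i\<in>I. f i (x i)) * indicator (Pi\<^sub>E I A) x \<partial>PiM I M)"
      using assms(1) A' by (intro emeasure_density) auto
    also have "\<dots> = (\<integral>\<^sup>+x. (\<Prod>i\<in>I. f i (x i) * indicator (A i) (x i)) \<partial>PiM I M)"
    proof (rule nn_integral_cong)
      fix x assume x: "x \<in> space (PiM I M)"
      have "(indicator (Pi\<^sub>E I A) x :: ennreal) = (\<Prod>i\<in>I. indicator (A i) (x i))"
      proof (cases "\<forall>i\<in>I. x i \<in> A i")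
        case True
        then show ?thesis using x by (auto simp: space_PiM PiE_iff)
      next
        case False
        then obtain j where "j \<in> I" "x j \<notin> A j" by auto
        then show ?thesis using \<open>finite I\<close> by (auto simp: PiE_iff indicator_def)
      qed
      then show "(\<Prod>i\<in>I. f i (x i)) * indicator (Pi\<^sub>E I A) x
        = (\<Prod>i\<in>I. f i (x i) * indicator (A i) (x i))"
        by (simp add: prod.distrib)
    qed
    also have "\<dots> = (\<Prod>i\<in>I. \<integral>\<^sup>+x. f i x * indicator (A i) x \<partial>M i)"
      by (rule M.product_nn_integral_prod) (use assms(1) in auto)
    also have "\<dots> = (\<Prod>i\<in>I. emeasure (density (M i) (f i)) (A i))"
      by (intro prod.cong refl) (simp add: emeasure_density)
    finally show "emeasure (density (PiM I M) (\<lambda>x. \<Prod>i\<in>I. f i (x i))) (Pi\<^sub>E I A)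
      = (\<Prod>i\<in>I. emeasure (density (M i) (f i)) (A i))" .
  qed fact
qed

lemma product_sigma_finite_lborel: "product_sigma_finite (\<lambda>_. lborel :: real measure)"
  by (simp add: product_sigma_finite_def lborel.sigma_finite_measure_axioms)

text \<open>Each coordinate is translation invariant and the preimage of a box is again a box. The
  restriction keeps the shifted sequence in the extensional product space.\<close>

lemma distr_PiM_lborel_translate:
  fixes h :: "'i \<Rightarrow> real"
  assumes "finite I"
  shows "distr (PiM I (\<lambda>_. lborel)) (PiM I (\<lambda>_. lborel)) (\<lambda>x. \<lambda>i\<in>I. h i + x i) = PiM I (\<lambda>_. lborel)"
proof -
  interpret product_sigma_finite "\<lambda>_::'i. lborel :: real measure"
    by (rule product_sigma_finite_lborel)
  show ?thesis
  proof (rule PiM_eqI)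
    fix A assume A: "\<And>i. i \<in> I \<Longrightarrow> A i \<in> sets (lborel :: real measure)"
    have pre: "(\<lambda>x. \<lambda>i\<in>I. h i + x i) -` (Pi\<^sub>E I A) \<inter> space (PiM I (\<lambda>_. lborel))
      = Pi\<^sub>E I (\<lambda>i. (+) (h i) -` A i)"
      by (auto simp: space_PiM PiE_iff)
    have [measurable]: "(\<lambda>x. \<lambda>i\<in>I. h i + x i) \<in> measurable (PiM I (\<lambda>_. lborel)) (PiM I (\<lambda>_. lborel))"
      by (rule measurable_restrict) measurable
    have vi: "(+) (h i) -` A i \<in> sets lborel" if "i \<in> I" for i
      using measurable_sets[of "(+) (h i)" lborel borel "A i"] A[OF that] by auto
    have "emeasure (distr (PiM I (\<lambda>_. lborel)) (PiM I (\<lambda>_. lborel)) (\<lambda>x. \<lambda>i\<in>I. h i + x i)) (Pi\<^sub>E I A)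
      = emeasure (PiM I (\<lambda>_. lborel)) (Pi\<^sub>E I (\<lambda>i. (+) (h i) -` A i))"
      using A assms by (subst emeasure_distr) (auto simp: pre intro!: sets_PiM_I_finite)
    also have "\<dots> = (\<Prod>i\<in>I. emeasure lborel ((+) (h i) -` A i))"
      using assms vi by (intro emeasure_PiM) auto
    also have "\<dots> = (\<Prod>i\<in>I. emeasure lborel (A i))"
    proof (intro prod.cong refl)
      fix i assume "i \<in> I"
      have "emeasure lborel (A i) = emeasure (distr lborel borel ((+) (h i))) (A i)"
        by (simp add: lborel_distr_plus)
      also have "\<dots> = emeasure lborel ((+) (h i) -` A i)"
        using A[OF \<open>i \<in> I\<close>] by (subst emeasure_distr) auto
      finally show "emeasure lborel ((+) (h i) -` A i) = emeasure lborel (A i)" by simp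
    qed
    finally show "emeasure (distr (PiM I (\<lambda>_. lborel)) (PiM I (\<lambda>_. lborel)) (\<lambda>x. \<lambda>i\<in>I. h i + x i)) (Pi\<^sub>E I A)
      = (\<Prod>i\<in>I. emeasure lborel (A i))" .
  qed (use assms in auto)
qed

lemma nn_integral_PiM_lborel_translate:
  fixes h :: "'i \<Rightarrow> real"
  assumes "finite I" "G \<in> borel_measurable (PiM I (\<lambda>_. borel))"
  shows "(\<integral>\<^sup>+x. G (\<lambda>i\<in>I. h i + x i) \<partial>PiM I (\<lambda>_. lborel)) = (\<integral>\<^sup>+x. G x \<partial>PiM I (\<lambda>_. lborel))"
proof -
  have s: "sets (PiM I (\<lambda>_. lborel :: real measure)) = sets (PiM I (\<lambda>_. borel))"
    by (intro sets_PiM_cong) auto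
  have G: "G \<in> borel_measurable (PiM I (\<lambda>_. lborel))"
    using assms(2) measurable_cong_sets[OF s refl] by blast
  have m: "(\<lambda>x. \<lambda>i\<in>I. h i + x i) \<in> measurable (PiM I (\<lambda>_. lborel)) (PiM I (\<lambda>_. lborel))"
    by (rule measurable_restrict) measurable
  show ?thesis
    by (subst (2) distr_PiM_lborel_translate[OF assms(1), of h, symmetric]) (simp add: nn_integral_distr[OF m] G)
qed

lemma prob_space_iid_gauss: "v > 0 \<Longrightarrow> prob_space (iid_gauss v n)"
  unfolding iid_gauss_def by (intro prob_space_PiM prob_space_normal_density) simp

lemma sets_iid_gauss[measurable_cong]: "sets (iid_gauss v n) = sets (PiM {..<n} (\<lambda>_. borel))"
  unfolding iid_gauss_def by (intro sets_PiM_cong) auto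

lemma iid_gauss_eq_density:
  assumes "v > 0"
  shows "iid_gauss v n = density (PiM {..<n} (\<lambda>_. lborel)) (\<lambda>x. \<Prod>i<n. ennreal (normal_density 0 (sqrt v) (x i)))"
  unfolding iid_gauss_def
proof (rule PiM_density)
  have "prob_space (density lborel (normal_density 0 (sqrt v)))"
    using assms by (intro prob_space_normal_density) simp
  then show "product_sigma_finite (\<lambda>i. density lborel (\<lambda>x. ennreal (normal_density 0 (sqrt v) x)))"
    unfolding product_sigma_finite_def
    by (meson prob_space_imp_sigma_finite)
qed (auto simp: product_sigma_finite_lborel)

text \<open>Dividing by the density of the noise turns its law into Lebesgue measure, which forgets
  the shift \<open>h\<close>. This passes from noise \<open>z\<close> to channel output
  \<open>h + z\<close> when state and messages, hence \<open>h\<close>, are fixed.\<close>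

lemma nn_integral_iid_gauss_translate:
  fixes h :: "nat \<Rightarrow> real"
  assumes v: "v > 0" and G[measurable]: "G \<in> borel_measurable (PiM {..<n} (\<lambda>_. borel))"
  shows "(\<integral>\<^sup>+z. G (\<lambda>i\<in>{..<n}. h i + z i) * ennreal (\<Prod>i<n. 1 / normal_density 0 (sqrt v) (z i)) \<partial>iid_gauss v n)
    = (\<integral>\<^sup>+y. G y \<partial>PiM {..<n} (\<lambda>_. lborel))"
proof -
  have s: "sets (PiM {..<n} (\<lambda>_. lborel :: real measure)) = sets (PiM {..<n} (\<lambda>_. borel))"
    by (intro sets_PiM_cong) auto
  have tm: "(\<lambda>z. \<lambda>i\<in>{..<n}. h i + z i) \<in> measurable (PiM {..<n} (\<lambda>_. lborel)) (PiM {..<n} (\<lambda>_. borel))"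
    by (rule measurable_restrict) measurable
  have [measurable]: "(\<lambda>z. G (\<lambda>i\<in>{..<n}. h i + z i)) \<in> borel_measurable (PiM {..<n} (\<lambda>_. lborel))"
    by (rule measurable_compose[OF tm G])
  have "(\<integral>\<^sup>+z. G (\<lambda>i\<in>{..<n}. h i + z i) * ennreal (\<Prod>i<n. 1 / normal_density 0 (sqrt v) (z i)) \<partial>iid_gauss v n)
     = (\<integral>\<^sup>+z. (\<Prod>i<n. ennreal (normal_density 0 (sqrt v) (z i))) * (G (\<lambda>i\<in>{..<n}. h i + z i) *
          ennreal (\<Prod>i<n. 1 / normal_density 0 (sqrt v) (z i))) \<partial>PiM {..<n} (\<lambda>_. lborel))"
    unfolding iid_gauss_eq_density[OF v] by (rule nn_integral_density) measurable
  also have "\<dots> = (\<integral>\<^sup>+z. G (\<lambda>i\<in>{..<n}. h i + z i) \<partial>PiM {..<n} (\<lambda>_. lborel))"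
  proof (rule nn_integral_cong)
    fix z :: "nat \<Rightarrow> real"
    have pos: "normal_density 0 (sqrt v) x > 0" for x using v by (intro normal_density_pos) simp
    have "(\<Prod>i<n. ennreal (normal_density 0 (sqrt v) (z i))) * ennreal (\<Prod>i<n. 1 / normal_density 0 (sqrt v) (z i))
      = ennreal ((\<Prod>i<n. normal_density 0 (sqrt v) (z i)) * (\<Prod>i<n. 1 / normal_density 0 (sqrt v) (z i)))"
      by (simp add: prod_ennreal ennreal_mult prod_nonneg)
    also have "\<dots> = 1"
      using pos[THEN less_imp_neq] by (simp add: prod.distrib[symmetric])
    finally show "(\<Prod>i<n. ennreal (normal_density 0 (sqrt v) (z i))) * (G (\<lambda>i\<in>{..<n}. h i + z i) *
          ennreal (\<Prod>i<n. 1 / normal_density 0 (sqrt v) (z i))) = G (\<lambda>i\<in>{..<n}. h i + z i)"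
      by (metis (no_types, lifting) mult.left_commute mult.right_neutral)
  qed
  also have "\<dots> = (\<integral>\<^sup>+y. G y \<partial>PiM {..<n} (\<lambda>_. lborel))"
    by (rule nn_integral_PiM_lborel_translate) auto
  finally show ?thesis .
qed

lemma nn_integral_PiM_normal_density:
  fixes m :: "nat \<Rightarrow> real"
  assumes "\<sigma> > 0"
  shows "(\<integral>\<^sup>+y. ennreal (\<Prod>i<n. normal_density (m i) \<sigma> (y i)) \<partial>PiM {..<n} (\<lambda>_. lborel)) = 1"
proof -
  interpret product_sigma_finite "\<lambda>_::nat. lborel :: real measure"
    by (rule product_sigma_finite_lborel)
  have "(\<integral>\<^sup>+y. ennreal (\<Prod>i<n. normal_density (m i) \<sigma> (y i)) \<partial>PiM {..<n} (\<lambda>_. lborel))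
    = (\<integral>\<^sup>+y. (\<Prod>i<n. ennreal (normal_density (m i) \<sigma> (y i))) \<partial>PiM {..<n} (\<lambda>_. lborel))"
    by (simp add: prod_ennreal)
  also have "\<dots> = (\<Prod>i<n. \<integral>\<^sup>+x. ennreal (normal_density (m i) \<sigma> x) \<partial>lborel)"
    by (rule product_nn_integral_prod[where f = "\<lambda>i x. ennreal (normal_density (m i) \<sigma> x)"]) auto
  also have "\<dots> = 1"
    using assms by (simp add: nn_integral_eq_integral)
  finally show ?thesis .
qed

section \<open>Change of measure\<close>

text \<open>Take \<open>L\<close> to be a log-likelihood ratio: the integral is then the exponential
  moment of \<open>c * indicator A\<close> under the alternative law. The logarithm in the
  Donsker-Varadhan inequality is replaced by its tangent at 2,
  \<open>ln x \<le> ln 2 + x / 2 - 1\<close>, so that the bounds \<open>B\<close> of different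
  messages can be added.\<close>

lemma (in prob_space) change_of_measure_bound:
  assumes A: "A \<in> events" and L: "integrable M L" and B: "B \<ge> 0"
    and le: "(\<integral>\<^sup>+x. ennreal (exp (c * indicator A x - L x)) \<partial>M) \<le> ennreal B"
  shows "c * prob A \<le> expectation L + ln 2 + B / 2 - 1"
proof -
  note A[measurable] and borel_measurable_integrable[OF L, measurable]
  have int: "integrable M (\<lambda>x. exp (c * indicator A x - L x))"
    using le by (intro integrableI_bounded) (auto simp: less_top[symmetric] top_unique)
  have intB: "(\<integral>x. exp (c * indicator A x - L x) \<partial>M) \<le> B"
    using le B by (simp add: nn_integral_eq_integral[OF int])
  have iA: "integrable M (\<lambda>x. c * indicator A x :: real)"
    by (intro integrable_mult_right) (simp add: emeasure_eq_measure)
  have pt: "c * indicator A x - L x - ln 2 \<le> exp (c * indicator A x - L x) / 2 - 1" for x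
    using ln_le_minus_one[of "exp (c * indicator A x - L x) / 2"] by (simp add: ln_div)
  have "(\<integral>x. c * indicator A x - L x - ln 2 \<partial>M) \<le> (\<integral>x. exp (c * indicator A x - L x) / 2 - 1 \<partial>M)"
    using pt by (intro integral_mono) (auto intro!: iA L int)
  also have "(\<integral>x. c * indicator A x - L x - ln 2 \<partial>M) = c * prob A - expectation L - ln 2"
    using iA L by (simp add: prob_space)
  also have "(\<integral>x. exp (c * indicator A x - L x) / 2 - 1 \<partial>M) = expectation (\<lambda>x. exp (c * indicator A x - L x)) / 2 - 1"
    using int by (simp add: prob_space)
  finally show ?thesis using intB by simp
qed


text \<open>The single bound is affine in \<open>B\<close>, so only the average exponential moment
  over the messages matters: when it is at most 2, \<open>B / 2 - 1\<close> averages to at most 0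
  and just \<open>ln 2\<close> per message remains.\<close>

lemma (in prob_space) sum_change_of_measure_bound:
  assumes J: "finite J" and A: "\<And>w. w \<in> J \<Longrightarrow> A w \<in> events"
    and L: "\<And>w. w \<in> J \<Longrightarrow> integrable M (L w)"
    and le: "(\<Sum>w\<in>J. \<integral>\<^sup>+x. ennreal (exp (c * indicator (A w) x - L w x)) \<partial>M) \<le> ennreal (2 * real (card J))"
  shows "c * (\<Sum>w\<in>J. prob (A w)) \<le> (\<Sum>w\<in>J. expectation (L w)) + real (card J) * ln 2"
proof -
  define I where "I w = (\<integral>\<^sup>+x. ennreal (exp (c * indicator (A w) x - L w x)) \<partial>M)" for w
  \<comment> \<open>Each moment is finite because the whole sum is, so its real value can serve as
    \<open>B\<close>.\<close>
  have fin: "I w < \<infinity>" if "w \<in> J" for w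
  proof -
    have "I w \<le> (\<Sum>w\<in>J. I w)"
      using that J by (intro member_le_sum) auto
    also have "\<dots> < \<infinity>"
      using le_less_trans[OF le ennreal_less_top] unfolding I_def by simp
    finally show ?thesis .
  qed
  have eq: "ennreal (enn2real (I w)) = I w" if "w \<in> J" for w
    using fin[OF that] by simp
  have "ennreal (\<Sum>w\<in>J. enn2real (I w)) = (\<Sum>w\<in>J. I w)"
    by (simp add: eq sum_ennreal[symmetric] del: ennreal_enn2real_if sum_ennreal)
  then have "ennreal (\<Sum>w\<in>J. enn2real (I w)) \<le> ennreal (2 * real (card J))"
    using le unfolding I_def by simp
  then have sumB: "(\<Sum>w\<in>J. enn2real (I w)) \<le> 2 * real (card J)"
    by (subst (asm) ennreal_le_iff) auto
  have "(\<Sum>w\<in>J. c * prob (A w)) \<le> (\<Sum>w\<in>J. expectation (L w) + ln 2 + enn2real (I w) / 2 - 1)"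
    using A L eq by (intro sum_mono change_of_measure_bound) (auto simp: I_def)
  also have "\<dots> = (\<Sum>w\<in>J. expectation (L w)) + real (card J) * ln 2 + (\<Sum>w\<in>J. enn2real (I w)) / 2 - real (card J)"
    by (simp add: sum.distrib sum_subtractf sum_divide_distrib)
  also have "\<dots> \<le> (\<Sum>w\<in>J. expectation (L w)) + real (card J) * ln 2"
    using sumB by simp
  finally show ?thesis by (simp add: sum_distrib_left)
qed

section \<open>Moments and explicit densities\<close>

text \<open>Independence of state and noise enters the second-moment computations in this
  form.\<close>

lemma (in pair_sigma_finite) has_bochner_integral_fst_times_snd:
  fixes g :: "'a \<Rightarrow> real" and h :: "'b \<Rightarrow> real"
  assumes g: "integrable M1 g" and h: "integrable M2 h"
  shows "has_bochner_integral (M1 \<Otimes>\<^sub>M M2) (\<lambda>x. g (fst x) * h (snd x)) ((\<integral>x. g x \<partial>M1) * (\<integral>x. h x \<partial>M2))"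
proof -
  note [measurable] = borel_measurable_integrable[OF g] borel_measurable_integrable[OF h]
  have int: "integrable (M1 \<Otimes>\<^sub>M M2) (\<lambda>x. g (fst x) * h (snd x))"
    using g h by (intro Fubini_integrable) (auto simp: abs_mult)
  then show ?thesis
    using integral_fst'[OF int] by (simp add: has_bochner_integral_iff)
qed

lemma iid_gauss_integral_component:
  assumes v: "v > 0" and i: "i < n"
  shows "integrable (iid_gauss v n) (\<lambda>s. s i)" "(\<integral>s. s i \<partial>iid_gauss v n) = 0"
    "integrable (iid_gauss v n) (\<lambda>s. (s i)\<^sup>2)" "(\<integral>s. (s i)\<^sup>2 \<partial>iid_gauss v n) = v"
proof -
  let ?g = "density lborel (normal_density 0 (sqrt v))"
  have d: "distr (iid_gauss v n) ?g (\<lambda>s. s i) = ?g"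
    unfolding iid_gauss_def using v i
    by (intro distr_PiM_component prob_space_normal_density) auto
  have m: "(\<lambda>s. s i) \<in> measurable (iid_gauss v n) ?g"
    using i by simp
  have 1: "has_bochner_integral ?g (\<lambda>x. x) 0"
    using v normal_moment_nz_1[of "sqrt v" 0] by (intro has_bochner_integral_density) auto
  have 2: "has_bochner_integral ?g (\<lambda>x. x\<^sup>2) v"
    using v normal_moment_even[of "sqrt v" 0 1] by (intro has_bochner_integral_density) auto
  have "has_bochner_integral (distr (iid_gauss v n) ?g (\<lambda>s. s i)) (\<lambda>x. x) 0"
    "has_bochner_integral (distr (iid_gauss v n) ?g (\<lambda>s. s i)) (\<lambda>x. x\<^sup>2) v"
    using 1 2 unfolding d by auto
  then show "integrable (iid_gauss v n) (\<lambda>s. s i)" "(\<integral>s. s i \<partial>iid_gauss v n) = 0"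
    "integrable (iid_gauss v n) (\<lambda>s. (s i)\<^sup>2)" "(\<integral>s. (s i)\<^sup>2 \<partial>iid_gauss v n) = v"
    by (auto simp: has_bochner_integral_iff integrable_distr_eq[OF m] integral_distr[OF m])
qed

lemma borel_measurable_normal_density_comp[measurable (raw)]:
  "f \<in> borel_measurable M \<Longrightarrow> g \<in> borel_measurable M \<Longrightarrow>
    (\<lambda>x. normal_density (f x) \<sigma> (g x)) \<in> borel_measurable M"
  unfolding normal_density_def by auto

lemma inverse_exp: "1 / exp x = exp (- x)" for x :: real
  by (simp add: exp_minus inverse_eq_divide)

lemma normal_density_eq_exp:
  assumes "v > 0"
  shows "normal_density m (sqrt v) x = exp (- (1 / (2 * v) * (x - m)\<^sup>2) - ln (2 * pi * v) / 2)"
proof -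
  have "1 / sqrt (2 * pi * v) = exp (- ln (2 * pi * v) / 2)"
    using assms by (simp add: ln_sqrt[symmetric] exp_minus inverse_eq_divide)
  then show ?thesis
    using assms unfolding normal_density_def
    by (simp add: mult_exp_exp add.commute)
qed

text \<open>A decision \<open>d\<close> equals at most one message, so at most one summand is
  \<open>card J\<close> and all others are 1; a \<open>d\<close> outside \<open>J\<close> matches
  none. In this sense decoding from an output independent of the message is mere guessing.\<close>

lemma sum_exp_indicator_le:
  assumes "finite J" "J \<noteq> {}"
  shows "(\<Sum>w\<in>J. exp (ln (real (card J)) * of_bool (d = w))) \<le> 2 * real (card J)"
proof -
  have c: "real (card J) \<ge> 1" using assms by (simp add: Suc_leI card_gt_0_iff)
  have "(\<Sum>w\<in>J. exp (ln (real (card J)) * of_bool (d = w))) = (\<Sum>w\<in>J. 1 + (if d = w then real (card J) - 1 else 0))"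
    using c by (intro sum.cong) auto
  also have "\<dots> = real (card J) + (if d \<in> J then real (card J) - 1 else 0)"
    using assms by (simp add: sum.distrib)
  also have "\<dots> \<le> 2 * real (card J)" using c by auto
  finally show ?thesis .
qed

subsection \<open>Second moments and the outer region\<close>

text \<open>\<open>q\<close> is the averaged second moment of \<alpha> S + \<beta> X2 + \<gamma> X1
  + \<delta> Z, with actual powers \<open>p1\<close>, \<open>p2\<close> and correlations
  \<open>c12\<close>, \<open>c2s\<close>. Its nonnegativity supplies every Cauchy-Schwarz
  inequality. Estimators are tuned to the powers \<open>P1\<close>, \<open>P2\<close>, and one pair
  of correlation coefficients serves both bounds.\<close>

lemma optimal_parameters:
  fixes Q N P1 P2 p1 p2 c12 c2s :: real and q :: "real \<Rightarrow> real \<Rightarrow> real \<Rightarrow> real \<Rightarrow> real"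
  assumes Q: "Q > 0" and N: "N > 0" and P1: "P1 \<ge> 0" and P2: "P2 \<ge> 0" and p1: "p1 \<le> P1" and p2: "p2 \<le> P2"
    and q: "\<And>\<alpha> \<beta> \<gamma> \<delta>. q \<alpha> \<beta> \<gamma> \<delta>
       = \<alpha>\<^sup>2 * Q + \<beta>\<^sup>2 * p2 + \<gamma>\<^sup>2 * p1 + \<delta>\<^sup>2 * N + 2 * \<alpha> * \<beta> * c2s + 2 * \<beta> * \<gamma> * c12"
    and q_nonneg: "\<And>\<alpha> \<beta> \<gamma> \<delta>. q \<alpha> \<beta> \<gamma> \<delta> \<ge> 0"
  obtains r12 r2s a b \<beta> \<gamma> sY sr s1 where
    "r12 \<in> {0..1}" "r2s \<in> {-1..0}" "r12\<^sup>2 + r2s\<^sup>2 \<le> 1" "sY > 0" "sr > 0" "s1 > 0"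
    "q 1 1 1 1 \<le> sY" "q (1 - a) (- a) (- a - b) (- a) \<le> sr" "q (- \<gamma>) (- \<beta>) 1 1 \<le> s1"
    "s1 / N \<le> 1 + P1 * ratio_term r12 r2s / N"
    "sY * sr / (Q * N) \<le> (1 + (sqrt P1 + r12 * sqrt P2)\<^sup>2 /
         (P2 * (1 - r12\<^sup>2 - r2s\<^sup>2) + (sqrt Q + r2s * sqrt P2)\<^sup>2 + N)) * (1 + P2 * (1 - r12\<^sup>2 - r2s\<^sup>2) / N)"
proof -
  have c12_0: "c12 = 0" if "P1 = 0"
  proof (rule ccontr)
    assume c: "c12 \<noteq> 0"
    have "p1 = 0" using p1 that q_nonneg[of 0 0 1 0] q[of 0 0 1 0] by simp
    \<comment> \<open>For \<open>p1 = 0\<close> the form is affine in \<gamma>, and this \<gamma>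
      makes it -1.\<close>
    then have "0 \<le> p2 + 2 * (- (p2 + 1) / (2 * c12)) * c12"
      using q_nonneg[of 0 1 "- (p2 + 1) / (2 * c12)" 0] q[of 0 1 "- (p2 + 1) / (2 * c12)" 0] by simp
    then show False using c by (simp add: field_simps)
  qed
  \<comment> \<open>If P1 = 0 then k = 0 by the convention on division, which is right because c12 = 0.\<close>
  define k where "k = c12 / P1"
  have kP1: "k * P1 = c12" using c12_0 by (auto simp: k_def)
  have kc: "k * c12 = k\<^sup>2 * P1" by (simp add: power2_eq_square kP1[symmetric])
  have kc0: "k * c12 \<ge> 0" using P1 by (simp add: kc)
  have kp: "k\<^sup>2 * p1 \<le> k * c12" unfolding kc using p1 by (intro mult_left_mono) auto
  \<comment> \<open>\<open>t\<close> is the part of the power of X2 explained by S and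
    \<open>k * c12\<close> the part explained by X1; at full powers \<open>v\<close> is what
    remains, the error of the best linear estimate of X2 from S and X1.\<close>
  define t where "t = c2s\<^sup>2 / Q"
  have t0: "t \<ge> 0" using Q by (simp add: t_def)
  define v where "v = P2 - k * c12 - t"
  have v0: "v \<ge> 0"
  proof -
    \<comment> \<open>This is the second moment of the residual X2 - (c2s / Q) S - k X1 at the
      actual powers; \<open>p2\<close> and \<open>kp\<close> carry it to full powers.\<close>
    have "0 \<le> q (- c2s / Q) 1 (- k) 0" by (rule q_nonneg)
    also have "\<dots> = p2 - t + k\<^sup>2 * p1 - 2 * (k * c12)"
      unfolding q t_def using Q by (simp add: field_simps power2_eq_square)
    finally show ?thesis unfolding v_def using p2 kp by linarith
  qed
  \<comment> \<open>The second moment of Y - (1 + k) X1 at full powers; \<open>Dv\<close> splits it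
    into the residual of X2, a multiple of S, and the noise.\<close>
  define D where "D = P2 - k * c12 + 2 * c2s + Q + N"
  have Dv: "D = v + (Q + c2s)\<^sup>2 / Q + N"
    unfolding D_def v_def t_def using Q by (simp add: field_simps power2_eq_square)
  have D0: "D > 0"
    unfolding Dv using v0 N Q by (intro add_nonneg_pos add_nonneg_nonneg) auto
  \<comment> \<open>a (Y - (1 + k) X1) is the linear MMSE estimate of S from X1 and Y, with error sr, if the powers are P1 and P2.\<close>
  define a where "a = (Q + c2s) / D"
  define sr where "sr = Q * (v + N) / D"
  have sr0: "sr > 0" unfolding sr_def using Q v0 N D0 by (auto intro!: divide_pos_pos mult_pos_pos)
  \<comment> \<open>The coefficients are those of S - a Y - b X1 with
    \<open>b = - a * (1 + k)\<close>.\<close>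
  have qr: "q (1 - a) (- a) (- a - (- a * (1 + k))) (- a) \<le> sr"
  proof -
    have "q (1 - a) (- a) (- a - (- a * (1 + k))) (- a)
      = (1 - a)\<^sup>2 * Q + a\<^sup>2 * p2 + a\<^sup>2 * (k\<^sup>2 * p1) + a\<^sup>2 * N - 2 * (1 - a) * a * c2s - 2 * a\<^sup>2 * (k * c12)"
      unfolding q by (simp add: algebra_simps power2_eq_square)
    also have "\<dots> \<le> (1 - a)\<^sup>2 * Q + a\<^sup>2 * P2 + a\<^sup>2 * (k * c12) + a\<^sup>2 * N - 2 * (1 - a) * a * c2s - 2 * a\<^sup>2 * (k * c12)"
      using mult_left_mono[OF p2, of "a\<^sup>2"] mult_left_mono[OF kp, of "a\<^sup>2"] by (auto simp: ac_simps)
    also have "\<dots> = Q - 2 * a * (Q + c2s) + a * (a * D)"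
      unfolding D_def by (simp add: algebra_simps power2_eq_square)
    also have "a * D = Q + c2s" unfolding a_def using D0 by simp
    also have "Q - 2 * a * (Q + c2s) + a * (Q + c2s) = (Q * D - (Q + c2s)\<^sup>2) / D"
      unfolding a_def using D0 by (simp add: field_simps power2_eq_square)
    also have "Q * D - (Q + c2s)\<^sup>2 = Q * (v + N)"
      unfolding Dv using Q by (simp add: field_simps)
    finally show ?thesis unfolding sr_def .
  qed
  define sY where "sY = P1 + P2 + 2 * c12 + Q + 2 * c2s + N"
  have qY: "q 1 1 1 1 \<le> sY" unfolding q sY_def using p1 p2 by simp
  have sY0: "sY > 0"
  proof -
    have "q 1 1 1 1 = q 1 1 1 0 + N" unfolding q by simp
    then show ?thesis using qY N q_nonneg[of 1 1 1 0] by linarith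
  qed
  \<comment> \<open>The error, at full power, of estimating X2 from S alone; it will equal
    \<open>P2 * (1 - r2s\<^sup>2)\<close>.\<close>
  define w where "w = P2 - t"
  have w0: "w \<ge> 0" using v0 kc0 by (simp add: v_def w_def)
  \<comment> \<open>Likewise \<beta> X2 + \<gamma> S estimates X1; w = 0 forces X2 to be a multiple of S, and \<beta> = 0.\<close>
  define \<beta> where "\<beta> = c12 / w"
  define \<gamma> where "\<gamma> = - \<beta> * c2s / Q"
  define s1 where "s1 = P1 + N + \<beta>\<^sup>2 * w - 2 * \<beta> * c12"
  have q1: "q (- \<gamma>) (- \<beta>) 1 1 \<le> s1"
  proof -
    have "q (- \<gamma>) (- \<beta>) 1 1 = p1 + N + \<beta>\<^sup>2 * (p2 - t) - 2 * \<beta> * c12"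
      unfolding q \<gamma>_def t_def using Q by (simp add: field_simps power2_eq_square)
    also have "\<dots> \<le> s1"
      unfolding s1_def w_def using p1 mult_left_mono[of "p2 - t" "P2 - t" "\<beta>\<^sup>2"] p2 by simp
    finally show ?thesis .
  qed
  have s10: "s1 > 0"
  proof -
    have "q (- \<gamma>) (- \<beta>) 1 1 = q (- \<gamma>) (- \<beta>) 1 0 + N" unfolding q by simp
    then show ?thesis using q1 N q_nonneg[of "- \<gamma>" "- \<beta>" 1 0] by linarith
  qed
  \<comment> \<open>Correlation coefficients relative to the full powers, with signs that can only
    increase the bounds: the final terms use squares, except that a positive \<open>c12\<close>
    enlarges a numerator and a negative \<open>c2s\<close> shrinks a denominator. If a power is 0,
    division by 0 gives the correct coefficient 0.\<close>
  define r12 where "r12 = \<bar>c12\<bar> / sqrt (P1 * P2)"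
  define r2s where "r2s = - (\<bar>c2s\<bar> / sqrt (P2 * Q))"
  \<comment> \<open>\<open>v \<ge> 0\<close> then forces the nonnegative terms
    \<open>k * c12\<close> and \<open>t\<close> to vanish.\<close>
  have P2_0: "t = 0 \<and> c2s = 0 \<and> c12 = 0" if "P2 = 0"
  proof -
    have "t = 0" "k * c12 = 0" using v0 t0 kc0 that unfolding v_def by linarith+
    then show ?thesis using Q kP1 by (auto simp: t_def)
  qed
  have r12_sq: "P1 * P2 * r12\<^sup>2 = c12\<^sup>2"
    using P1 P2 c12_0 P2_0 by (auto simp: r12_def power_divide)
  have r12_P2: "P2 * r12\<^sup>2 = k * c12"
    using P1 P2 c12_0 P2_0 by (cases "P1 = 0"; cases "P2 = 0") (auto simp: r12_def k_def power_divide power2_eq_square)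
  have r2s_P2: "P2 * r2s\<^sup>2 = t"
    using P2 Q P2_0 by (cases "P2 = 0") (auto simp: r2s_def t_def power_divide)
  have vP2: "P2 * (1 - r12\<^sup>2 - r2s\<^sup>2) = v"
    unfolding v_def r12_P2[symmetric] r2s_P2[symmetric] by (simp add: algebra_simps)
  have r_sq: "r12\<^sup>2 + r2s\<^sup>2 \<le> 1"
  proof (cases "P2 = 0")
    case True
    then show ?thesis by (simp add: r12_def r2s_def)
  next
    case False
    then have "0 \<le> 1 - r12\<^sup>2 - r2s\<^sup>2"
      using v0 P2 unfolding vP2[symmetric] by (simp add: zero_le_mult_iff)
    then show ?thesis by simp
  qed
  have r12: "r12 \<in> {0..1}"
  proof -
    have "r12\<^sup>2 \<le> 1" using r_sq zero_le_power2[of r2s] by linarith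
    then have "r12 \<le> 1" by (simp add: abs_square_le_1)
    moreover have "r12 \<ge> 0" using P1 P2 by (simp add: r12_def)
    ultimately show ?thesis by simp
  qed
  have r2s: "r2s \<in> {-1..0}"
  proof -
    have "r2s\<^sup>2 \<le> 1" using r_sq zero_le_power2[of r12] by linarith
    then have "\<bar>r2s\<bar> \<le> 1" by (simp add: abs_square_le_1)
    moreover have "r2s \<le> 0" using Q P2 by (simp add: r2s_def)
    ultimately show ?thesis by simp
  qed
  have ratio: "s1 \<le> N + P1 * ratio_term r12 r2s"
  proof (cases "w = 0")
    case True
    then have "s1 = P1 + N" by (simp add: s1_def \<beta>_def)
    moreover have "ratio_term r12 r2s = 1"
    proof (cases "P2 = 0")
      case True
      then show ?thesis by (simp add: ratio_term_def r12_def r2s_def)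
    next
      case False
      then have "r2s\<^sup>2 = 1" using True r2s_P2 by (simp add: w_def)
      then have "r2s = -1" using r2s by (auto simp: power2_eq_1_iff)
      then show ?thesis by (simp add: ratio_term_def)
    qed
    ultimately show ?thesis by simp
  next
    case False
    have w: "w = P2 * (1 - r2s\<^sup>2)" unfolding w_def r2s_P2[symmetric] by (simp add: algebra_simps)
    then have nz: "P2 \<noteq> 0" "1 - r2s\<^sup>2 \<noteq> 0" using False by auto
    then have ne: "r2s \<noteq> -1" by auto
    have "P1 * ratio_term r12 r2s = P1 - P1 * P2 * r12\<^sup>2 / w"
      unfolding w ratio_term_def using ne nz by (simp add: field_simps)
    also have "\<dots> = P1 - c12\<^sup>2 / w" unfolding r12_sq ..
    also have "\<dots> = s1 - N" unfolding s1_def \<beta>_def using False by (simp add: field_simps power2_eq_square)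
    finally show ?thesis by simp
  qed
  have ratio': "s1 / N \<le> 1 + P1 * ratio_term r12 r2s / N"
    using ratio N by (simp add: field_simps)
  have cross12: "sqrt P1 * (r12 * sqrt P2) = \<bar>c12\<bar>"
    using P1 P2 c12_0 P2_0 by (auto simp: r12_def real_sqrt_mult)
  have cross2s: "sqrt Q * (r2s * sqrt P2) = - \<bar>c2s\<bar>"
    using Q P2 P2_0 by (auto simp: r2s_def real_sqrt_mult)
  have A: "(sqrt P1 + r12 * sqrt P2)\<^sup>2 = P1 + 2 * \<bar>c12\<bar> + k * c12"
    unfolding power2_sum power_mult_distrib mult.assoc cross12 using P1 P2 r12_P2 by (simp add: mult.commute)
  have C: "(sqrt Q + r2s * sqrt P2)\<^sup>2 = Q - 2 * \<bar>c2s\<bar> + t"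
    unfolding power2_sum power_mult_distrib mult.assoc cross2s using Q P2 r2s_P2 by (simp add: mult.commute)
  define D' where "D' = v + (Q - 2 * \<bar>c2s\<bar> + t) + N"
  have D'0: "D' > 0"
    unfolding D'_def C[symmetric] using v0 N by (intro add_nonneg_pos add_nonneg_nonneg) auto
  have D'D: "D' \<le> D" unfolding D'_def D_def v_def by simp
  \<comment> \<open>At full powers Y is the sum of (1 + k) X1 and an uncorrelated remainder of
    second moment \<open>D\<close>; \<open>A0\<close> is the second moment of the first summand,
    hence \<open>sY = A0 + D\<close>.\<close>
  define A0 where "A0 = P1 + 2 * c12 + k * c12"
  have A0: "A0 \<ge> 0"
  proof -
    have "A0 = P1 * (1 + k)\<^sup>2" unfolding A0_def kP1[symmetric] by (simp add: algebra_simps power2_eq_square)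
    then show ?thesis using P1 by simp
  qed
  have "sY * sr / (Q * N) = (1 + A0 / D) * (1 + v / N)"
  proof -
    have "sY = A0 + D" unfolding sY_def A0_def D_def by simp
    then show ?thesis unfolding sr_def using Q N D0 by (simp add: field_simps)
  qed
  also have "\<dots> \<le> (1 + (P1 + 2 * \<bar>c12\<bar> + k * c12) / D') * (1 + v / N)"
    using A0 D'D D'0 D0 v0 N unfolding A0_def
    by (intro mult_right_mono add_left_mono frac_le) auto
  finally have "sY * sr / (Q * N) \<le> (1 + (sqrt P1 + r12 * sqrt P2)\<^sup>2 /
         (P2 * (1 - r12\<^sup>2 - r2s\<^sup>2) + (sqrt Q + r2s * sqrt P2)\<^sup>2 + N)) * (1 + P2 * (1 - r12\<^sup>2 - r2s\<^sup>2) / N)"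
    unfolding vP2 A C D'_def .
  from that[OF r12 r2s r_sq sY0 sr0 s10 qY qr q1 ratio' this] show ?thesis .
qed


section \<open>Closedness of the outer region\<close>

text \<open>The region is the projection of a closed set of parameters and rate pairs along a
  compact set of parameters, and such projections are closed.\<close>

lemma closed_outer_region:
  fixes Q N P1 P2 :: real
  assumes N: "N > 0" and P1: "P1 \<ge> 0" and P2: "P2 \<ge> 0"
  shows "closed (outer_region Q N P1 P2)"
proof -
  define B1 where "B1 x = 1/2 * log 2 (1 + P1 * x / N)" for x
  define B2 where "B2 r12 r2s = 1/2 * log 2 (1 + (sqrt P1 + r12 * sqrt P2)\<^sup>2 /
         (P2 * (1 - r12\<^sup>2 - r2s\<^sup>2) + (sqrt Q + r2s * sqrt P2)\<^sup>2 + N))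
       + 1/2 * log 2 (1 + P2 * (1 - r12\<^sup>2 - r2s\<^sup>2) / N)" for r12 r2s
  \<comment> \<open>ratio_term is discontinuous at (0, -1), but only upwards: relaxing its value to a third parameter
    below it makes all constraints closed and leaves the region unchanged.\<close>
  define K :: "(real \<times> real \<times> real) set" where
    "K = {p \<in> {p \<in> {0..1} \<times> {-1..0} \<times> {0..1}. (fst p)\<^sup>2 + (fst (snd p))\<^sup>2 \<le> 1}.
       snd (snd p) * (1 - (fst (snd p))\<^sup>2) \<le> 1 - (fst p)\<^sup>2 - (fst (snd p))\<^sup>2}"
  have box: "compact ({0..1} \<times> {-1..0} \<times> {0..1} :: (real \<times> real \<times> real) set)"
    by (intro compact_Times) auto
  have "closed K"
    unfolding K_def
    by (intro continuous_on_closed_Collect_le compact_imp_closed[OF box] continuous_intros)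
  moreover have "K \<subseteq> {0..1} \<times> {-1..0} \<times> {0..1}"
    unfolding K_def by auto
  ultimately have K: "compact K"
    using compact_Int_closed[OF box, of K] by (simp add: Int_absorb1)
  define T where "T = {z \<in> {z \<in> K \<times> (UNIV :: (real \<times> real) set). snd (snd z) \<le> B1 (snd (snd (fst z)))}.
      fst (snd z) + snd (snd z) \<le> B2 (fst (fst z)) (fst (snd (fst z)))}"
  have KU: "closed (K \<times> (UNIV :: (real \<times> real) set))"
    by (rule closed_Times[OF compact_imp_closed[OF K] closed_UNIV])
  have pos1: "1 + P1 * snd (snd p) / N > 0" if "p \<in> K" for p
    using that P1 N by (auto simp: K_def intro!: add_pos_nonneg divide_nonneg_pos)
  have pos2: "P2 * (1 - (fst p)\<^sup>2 - (fst (snd p))\<^sup>2) \<ge> 0" if "p \<in> K" for p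
    using that P2 by (auto simp: K_def)
  have pos3: "P2 * (1 - (fst p)\<^sup>2 - (fst (snd p))\<^sup>2) + (sqrt Q + fst (snd p) * sqrt P2)\<^sup>2 + N > 0" if "p \<in> K" for p
    using pos2[OF that] N by (intro add_nonneg_pos add_nonneg_nonneg) auto
  have pos4: "1 + (sqrt P1 + fst p * sqrt P2)\<^sup>2 /
      (P2 * (1 - (fst p)\<^sup>2 - (fst (snd p))\<^sup>2) + (sqrt Q + fst (snd p) * sqrt P2)\<^sup>2 + N) > 0" if "p \<in> K" for p
    by (rule add_pos_nonneg[OF zero_less_one divide_nonneg_pos[OF zero_le_power2 pos3[OF that]]])
  have pos5: "1 + P2 * (1 - (fst p)\<^sup>2 - (fst (snd p))\<^sup>2) / N > 0" if "p \<in> K" for p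
    using pos2[OF that] N by (intro add_pos_nonneg divide_nonneg_pos) auto
  note nz = pos1[THEN less_imp_neq, symmetric] pos3[THEN less_imp_neq, symmetric]
    pos4[THEN less_imp_neq, symmetric] pos5[THEN less_imp_neq, symmetric]
  have cont1: "continuous_on K (\<lambda>p. B1 (snd (snd p)))"
    unfolding B1_def using N by (intro continuous_intros ballI nz) auto
  have cont2: "continuous_on K (\<lambda>p. B2 (fst p) (fst (snd p)))"
    unfolding B2_def using N by (intro continuous_intros ballI nz) auto
  have cont_fst: "continuous_on (K \<times> UNIV) (\<lambda>z. f (fst z))" if "continuous_on K f" for f :: "_ \<Rightarrow> real"
    by (rule continuous_on_compose2[OF that continuous_on_fst[OF continuous_on_id]]) auto
  have c1: "closed {z \<in> K \<times> (UNIV :: (real \<times> real) set). snd (snd z) \<le> B1 (snd (snd (fst z)))}"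
    using KU cont_fst[OF cont1] by (intro continuous_on_closed_Collect_le continuous_intros) auto
  have "closed T"
    unfolding T_def
    by (intro continuous_on_closed_Collect_le[OF _ _ c1] continuous_intros
        continuous_on_subset[OF cont_fst[OF cont2]]) auto
  from closed_compact_projection[OF K this]
  have "closed {y. \<exists>p. p \<in> K \<and> (p, y) \<in> T}" .
  moreover have "outer_region Q N P1 P2 = {y. \<exists>p. p \<in> K \<and> (p, y) \<in> T}"
  proof (intro set_eqI iffI)
    fix y assume "y \<in> outer_region Q N P1 P2"
    then obtain r12 r2s where r: "r12 \<in> {0..1}" "r2s \<in> {-1..0}" "r12\<^sup>2 + r2s\<^sup>2 \<le> 1"
      and y: "snd y \<le> B1 (ratio_term r12 r2s)" "fst y + snd y \<le> B2 r12 r2s"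
      unfolding outer_region_def B1_def B2_def by (auto split: if_splits)
    have "ratio_term r12 r2s \<in> {0..1} \<and> ratio_term r12 r2s * (1 - r2s\<^sup>2) \<le> 1 - r12\<^sup>2 - r2s\<^sup>2"
    proof (cases "r2s = -1")
      case True
      then show ?thesis using r by (simp add: ratio_term_def)
    next
      case False
      then have "\<bar>r2s\<bar> < 1" using r by auto
      then have "1 - r2s\<^sup>2 > 0" by (simp add: abs_square_less_1)
      then show ?thesis using r False by (auto simp: ratio_term_def divide_simps)
    qed
    then have "(r12, r2s, ratio_term r12 r2s) \<in> K" using r by (auto simp: K_def)
    then show "y \<in> {y. \<exists>p. p \<in> K \<and> (p, y) \<in> T}"
      using y by (intro CollectI exI[of _ "(r12, r2s, ratio_term r12 r2s)"]) (auto simp: T_def)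
  next
    fix y assume "y \<in> {y. \<exists>p. p \<in> K \<and> (p, y) \<in> T}"
    then obtain r12 r2s x where K: "(r12, r2s, x) \<in> K"
      and y: "snd y \<le> B1 x" "fst y + snd y \<le> B2 r12 r2s"
      by (auto simp: T_def)
    have r: "r12 \<in> {0..1}" "r2s \<in> {-1..0}" "r12\<^sup>2 + r2s\<^sup>2 \<le> 1" and x: "x \<in> {0..1}"
      "x * (1 - r2s\<^sup>2) \<le> 1 - r12\<^sup>2 - r2s\<^sup>2" using K by (auto simp: K_def)
    \<comment> \<open>\<open>B1\<close> is monotone, so replacing the relaxed \<open>x\<close> by
      \<open>ratio_term\<close> keeps the pair feasible.\<close>
    have "x \<le> ratio_term r12 r2s"
    proof (cases "r2s = -1")
      case True
      then show ?thesis using x by (simp add: ratio_term_def)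
    next
      case False
      then have "\<bar>r2s\<bar> < 1" using r by auto
      then have "1 - r2s\<^sup>2 > 0" by (simp add: abs_square_less_1)
      then show ?thesis using x False by (simp add: ratio_term_def pos_le_divide_eq)
    qed
    moreover have "0 < 1 + P1 * x / N" using pos1[OF K] by simp
    ultimately have "B1 x \<le> B1 (ratio_term r12 r2s)"
      unfolding B1_def using P1 N
      by (intro mult_left_mono log_mono add_left_mono divide_right_mono) auto
    then have "snd y \<le> B1 (ratio_term r12 r2s)" using y by simp
    then show "y \<in> outer_region Q N P1 P2"
      unfolding outer_region_def using r y
      by (intro UN_I[of r12] UN_I[of r2s]) (auto simp: B1_def B2_def case_prod_beta)
  qed
  ultimately show ?thesis by simp
qed

subsection \<open>Codes for the Gaussian channel\<close>

locale gauss_mac_code =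
  fixes Q N P1 P2 :: real and n Mc M1 :: nat
    and f1 :: "nat \<Rightarrow> nat \<Rightarrow> nat \<Rightarrow> real" and f2 :: "(nat \<Rightarrow> real) \<Rightarrow> nat \<Rightarrow> nat \<Rightarrow> real"
    and dec :: "(nat \<Rightarrow> real) \<Rightarrow> nat \<times> nat"
  assumes Q: "Q > 0" and N: "N > 0" and n: "n > 0" and Mc: "Mc > 0" and M1: "M1 > 0"
    and code: "is_code Q P1 P2 n Mc M1 f1 f2 dec"
begin

abbreviation SZ :: "((nat \<Rightarrow> real) \<times> (nat \<Rightarrow> real)) measure" where
  "SZ \<equiv> iid_gauss Q n \<Otimes>\<^sub>M iid_gauss N n"

text \<open>In the paper's notation this is \<alpha> S + \<beta> X2 + \<gamma> X1 + \<delta> Z at time i.\<close>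
definition lin :: "real \<Rightarrow> real \<Rightarrow> real \<Rightarrow> real \<Rightarrow> nat \<Rightarrow> nat \<Rightarrow> nat \<Rightarrow> (nat \<Rightarrow> real) \<times> (nat \<Rightarrow> real) \<Rightarrow> real" where
  "lin \<alpha> \<beta> \<gamma> \<delta> wc w1 i sz =
     \<alpha> * fst sz i + \<beta> * f2 (fst sz) wc i + \<gamma> * f1 wc w1 i + \<delta> * snd sz i"

text \<open>Expectation over uniformly distributed messages and a uniformly distributed time index,
  the latter in the role of a time-sharing variable.\<close>

definition avg :: "(nat \<Rightarrow> nat \<Rightarrow> nat \<Rightarrow> real) \<Rightarrow> real" where
  "avg F = (\<Sum>wc<Mc. \<Sum>w1<M1. \<Sum>i<n. F wc w1 i) / (real Mc * real M1 * real n)"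

text \<open>As a function of its coefficients this carries the second-moment matrix of S, X2, X1, Z
  averaged over messages and time, through which a code's encoders enter the two bounds.\<close>

definition quad :: "real \<Rightarrow> real \<Rightarrow> real \<Rightarrow> real \<Rightarrow> real" where
  "quad \<alpha> \<beta> \<gamma> \<delta> = avg (\<lambda>wc w1 i. \<integral>sz. (lin \<alpha> \<beta> \<gamma> \<delta> wc w1 i sz)\<^sup>2 \<partial>SZ)"

definition correct :: "nat \<Rightarrow> nat \<Rightarrow> ((nat \<Rightarrow> real) \<times> (nat \<Rightarrow> real)) set" where
  "correct wc w1 = {sz \<in> space SZ.
     dec (chan_out n (f1 wc w1) (f2 (fst sz) wc) (fst sz) (snd sz)) = (wc, w1)}"

sublocale S: prob_space "iid_gauss Q n" using Q by (rule prob_space_iid_gauss)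
sublocale Z: prob_space "iid_gauss N n" using N by (rule prob_space_iid_gauss)
sublocale pair_prob_space "iid_gauss Q n" "iid_gauss N n" ..

lemma measurable_f2[measurable]:
  "wc < Mc \<Longrightarrow> i < n \<Longrightarrow> (\<lambda>s. f2 s wc i) \<in> borel_measurable (PiM {..<n} (\<lambda>_. borel))"
  using code measurable_cong_sets[OF sets_iid_gauss[of Q n] refl]
  unfolding is_code_def by blast

lemma measurable_dec[measurable]: "dec \<in> measurable (PiM {..<n} (\<lambda>_. borel)) (count_space UNIV)"
  using code unfolding is_code_def by auto

lemma power_f1: "wc < Mc \<Longrightarrow> w1 < M1 \<Longrightarrow> (\<Sum>i<n. (f1 wc w1 i)\<^sup>2) \<le> real n * P1"
  using code unfolding is_code_def by auto

lemma power_f2: "s \<in> space (iid_gauss Q n) \<Longrightarrow> wc < Mc \<Longrightarrow> (\<Sum>i<n. (f2 s wc i)\<^sup>2) \<le> real n * P2"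
  using code unfolding is_code_def by auto

lemma measurable_chan_out[measurable]:
  "wc < Mc \<Longrightarrow> (\<lambda>sz. chan_out n (f1 wc w1) (f2 (fst sz) wc) (fst sz) (snd sz))
     \<in> measurable SZ (PiM {..<n} (\<lambda>_. borel))"
  unfolding chan_out_def by (rule measurable_restrict) measurable

lemma correct_event: "wc < Mc \<Longrightarrow> correct wc w1 \<in> sets SZ"
  unfolding correct_def by measurable

section \<open>Averaged second moments of a code\<close>

text \<open>The power constraint holds for every state sequence, so each X2 symbol is bounded by
  \<open>sqrt (real n * P2)\<close>; for the product with S, \<open>|a b| \<le> a^2 + b^2\<close>
  suffices.\<close>

lemma f2_integrable:
  assumes wc: "wc < Mc" and i: "i < n"
  shows "integrable (iid_gauss Q n) (\<lambda>s. f2 s wc i)"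
    "integrable (iid_gauss Q n) (\<lambda>s. (f2 s wc i)\<^sup>2)"
    "integrable (iid_gauss Q n) (\<lambda>s. s i * f2 s wc i)"
proof -
  have sq: "(f2 s wc i)\<^sup>2 \<le> real n * P2" if "s \<in> space (iid_gauss Q n)" for s
  proof -
    have "(f2 s wc i)\<^sup>2 \<le> (\<Sum>i<n. (f2 s wc i)\<^sup>2)" using i by (intro member_le_sum) auto
    then show ?thesis using power_f2[OF that wc] by simp
  qed
  have ab: "\<bar>f2 s wc i\<bar> \<le> sqrt (real n * P2)" if "s \<in> space (iid_gauss Q n)" for s
    using real_sqrt_le_mono[OF sq[OF that]] by simp
  show 2: "integrable (iid_gauss Q n) (\<lambda>s. (f2 s wc i)\<^sup>2)"
    using sq wc i by (intro S.integrable_const_bound[of _ "real n * P2"] AE_I2) auto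
  show "integrable (iid_gauss Q n) (\<lambda>s. f2 s wc i)"
    using ab wc i by (intro S.integrable_const_bound[of _ "sqrt (real n * P2)"] AE_I2) auto
  have "integrable (iid_gauss Q n) (\<lambda>s. (s i)\<^sup>2 + (f2 s wc i)\<^sup>2)"
    using iid_gauss_integral_component[OF Q i] 2 by auto
  then show "integrable (iid_gauss Q n) (\<lambda>s. s i * f2 s wc i)"
  proof (rule Bochner_Integration.integrable_bound)
    show "(\<lambda>s. s i * f2 s wc i) \<in> borel_measurable (iid_gauss Q n)" using wc i by auto
    have "\<bar>a * b\<bar> \<le> a\<^sup>2 + b\<^sup>2" for a b :: real
      using sum_squares_bound[of "\<bar>a\<bar>" "\<bar>b\<bar>"] abs_ge_zero[of "a * b"] unfolding abs_mult power2_abs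
      by linarith
    then show "AE s in iid_gauss Q n. norm (s i * f2 s wc i) \<le> norm ((s i)\<^sup>2 + (f2 s wc i)\<^sup>2)"
      by auto
  qed
qed

text \<open>Terms linear in the noise vanish by independence and mean zero, and so does the product
  of S with X1, a constant given the messages. X1 and X2 share the common message, so their product
  remains.\<close>

lemma has_bochner_integral_lin_sq:
  assumes wc: "wc < Mc" and i: "i < n"
  shows "has_bochner_integral SZ (\<lambda>sz. (lin \<alpha> \<beta> \<gamma> \<delta> wc w1 i sz)\<^sup>2)
    (\<alpha>\<^sup>2 * Q + \<beta>\<^sup>2 * S.expectation (\<lambda>s. (f2 s wc i)\<^sup>2) + \<gamma>\<^sup>2 * (f1 wc w1 i)\<^sup>2 + \<delta>\<^sup>2 * N
      + 2 * \<alpha> * \<beta> * S.expectation (\<lambda>s. s i * f2 s wc i)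
      + 2 * \<beta> * \<gamma> * (f1 wc w1 i * S.expectation (\<lambda>s. f2 s wc i)))"
proof -
  note cs = iid_gauss_integral_component[OF Q i]
  note cz = iid_gauss_integral_component[OF N i]
  note cf = f2_integrable[OF wc i]
  have one: "integrable (iid_gauss Q n) (\<lambda>_. 1 :: real)" "integrable (iid_gauss N n) (\<lambda>_. 1 :: real)"
    by auto
  \<comment> \<open>The square is sorted by powers of the noise: \<open>?g1\<close> is the
    coefficient of degree 0 and \<open>?g2\<close> that of degree 1.\<close>
  let ?g1 = "\<lambda>s. \<alpha>\<^sup>2 * (s i)\<^sup>2 + \<beta>\<^sup>2 * (f2 s wc i)\<^sup>2 + \<gamma>\<^sup>2 * (f1 wc w1 i)\<^sup>2
      + 2 * \<alpha> * \<beta> * (s i * f2 s wc i) + 2 * \<alpha> * \<gamma> * f1 wc w1 i * s i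
      + 2 * \<beta> * \<gamma> * f1 wc w1 i * f2 s wc i"
  let ?g2 = "\<lambda>s. 2 * \<delta> * (\<alpha> * s i + \<beta> * f2 s wc i + \<gamma> * f1 wc w1 i)"
  have i1: "integrable (iid_gauss Q n) ?g1" and i2: "integrable (iid_gauss Q n) ?g2"
    using cs cf by (auto intro!: Bochner_Integration.integrable_add integrable_mult_right)
  have e1: "S.expectation ?g1 = \<alpha>\<^sup>2 * Q + \<beta>\<^sup>2 * S.expectation (\<lambda>s. (f2 s wc i)\<^sup>2) + \<gamma>\<^sup>2 * (f1 wc w1 i)\<^sup>2
      + 2 * \<alpha> * \<beta> * S.expectation (\<lambda>s. s i * f2 s wc i)
      + 2 * \<beta> * \<gamma> * (f1 wc w1 i * S.expectation (\<lambda>s. f2 s wc i))"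
    using cs cf by (simp add: S.prob_space)
  have "has_bochner_integral SZ (\<lambda>sz. ?g1 (fst sz) * 1 + ?g2 (fst sz) * snd sz i + \<delta>\<^sup>2 * (1 * (snd sz i)\<^sup>2))
    (S.expectation ?g1 * Z.expectation (\<lambda>_. 1) + S.expectation ?g2 * Z.expectation (\<lambda>z. z i)
      + \<delta>\<^sup>2 * (S.expectation (\<lambda>_. 1) * Z.expectation (\<lambda>z. (z i)\<^sup>2)))"
    by (intro has_bochner_integral_add has_bochner_integral_mult_right
        has_bochner_integral_fst_times_snd[where g = ?g1 and h = "\<lambda>_. 1"]
        has_bochner_integral_fst_times_snd[where g = ?g2 and h = "\<lambda>z. z i"]
        has_bochner_integral_fst_times_snd[where g = "\<lambda>_. 1" and h = "\<lambda>z. (z i)\<^sup>2"] i1 i2 cz one)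
  then have "has_bochner_integral SZ (\<lambda>sz. ?g1 (fst sz) * 1 + ?g2 (fst sz) * snd sz i + \<delta>\<^sup>2 * (1 * (snd sz i)\<^sup>2))
    (S.expectation ?g1 + \<delta>\<^sup>2 * N)"
    using cz by (simp add: S.prob_space Z.prob_space)
  then show ?thesis
    unfolding e1 by (rule has_bochner_integral_cong[THEN iffD1, rotated 3])
      (auto simp: lin_def power2_eq_square algebra_simps)
qed

lemma integrable_lin_sq: "wc < Mc \<Longrightarrow> i < n \<Longrightarrow> integrable SZ (\<lambda>sz. (lin \<alpha> \<beta> \<gamma> \<delta> wc w1 i sz)\<^sup>2)"
  using has_bochner_integral_lin_sq by (auto simp: has_bochner_integral_iff)

lemma avg_cong:
  "(\<And>wc w1 i. wc < Mc \<Longrightarrow> w1 < M1 \<Longrightarrow> i < n \<Longrightarrow> F wc w1 i = G wc w1 i) \<Longrightarrow> avg F = avg G"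
  unfolding avg_def by simp

lemma avg_add: "avg (\<lambda>wc w1 i. F wc w1 i + G wc w1 i) = avg F + avg G"
  unfolding avg_def by (simp add: sum.distrib add_divide_distrib)

lemma avg_mult: "avg (\<lambda>wc w1 i. k * F wc w1 i) = k * avg F"
  unfolding avg_def by (simp add: sum_distrib_left)

lemma avg_const: "avg (\<lambda>_ _ _. k) = k"
  using n Mc M1 unfolding avg_def by simp

lemma sum_const_le_imp_avg_le:
  assumes "\<And>wc w1. wc < Mc \<Longrightarrow> w1 < M1 \<Longrightarrow> (\<Sum>i<n. F wc w1 i) \<le> real n * k"
  shows "avg F \<le> k"
proof -
  have "(\<Sum>wc<Mc. \<Sum>w1<M1. \<Sum>i<n. F wc w1 i) \<le> (\<Sum>wc<Mc. \<Sum>w1<M1. real n * k)"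
    using assms by (intro sum_mono) auto
  then show ?thesis using n Mc M1 unfolding avg_def by (simp add: field_simps)
qed

text \<open>Averaging is linear, so the pointwise formula yields a single quadratic form with
  averaged entries, exactly what \<open>optimal_parameters\<close> expects. The power constraints
  bound its diagonal entries \<open>p1\<close> and \<open>p2\<close>.\<close>

lemma quad_eq:
  obtains p1 p2 c12 c2s where "p1 \<le> P1" "p2 \<le> P2"
    "\<And>\<alpha> \<beta> \<gamma> \<delta>. quad \<alpha> \<beta> \<gamma> \<delta>
       = \<alpha>\<^sup>2 * Q + \<beta>\<^sup>2 * p2 + \<gamma>\<^sup>2 * p1 + \<delta>\<^sup>2 * N + 2 * \<alpha> * \<beta> * c2s + 2 * \<beta> * \<gamma> * c12"
proof
  let ?p1 = "avg (\<lambda>wc w1 i. (f1 wc w1 i)\<^sup>2)"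
  let ?p2 = "avg (\<lambda>wc w1 i. S.expectation (\<lambda>s. (f2 s wc i)\<^sup>2))"
  let ?c2s = "avg (\<lambda>wc w1 i. S.expectation (\<lambda>s. s i * f2 s wc i))"
  let ?c12 = "avg (\<lambda>wc w1 i. f1 wc w1 i * S.expectation (\<lambda>s. f2 s wc i))"
  show "?p1 \<le> P1" by (intro sum_const_le_imp_avg_le power_f1)
  show "?p2 \<le> P2"
  proof (intro sum_const_le_imp_avg_le)
    fix wc w1 assume "wc < Mc"
    then have "(\<Sum>i<n. S.expectation (\<lambda>s. (f2 s wc i)\<^sup>2)) = S.expectation (\<lambda>s. \<Sum>i<n. (f2 s wc i)\<^sup>2)"
      using f2_integrable by (intro Bochner_Integration.integral_sum[symmetric]) auto
    also have "\<dots> \<le> real n * P2"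
      using \<open>wc < Mc\<close> power_f2 f2_integrable by (intro S.integral_le_const AE_I2) auto
    finally show "(\<Sum>i<n. S.expectation (\<lambda>s. (f2 s wc i)\<^sup>2)) \<le> real n * P2" .
  qed
  fix \<alpha> \<beta> \<gamma> \<delta>
  have "quad \<alpha> \<beta> \<gamma> \<delta> = avg (\<lambda>wc w1 i. \<alpha>\<^sup>2 * Q + \<beta>\<^sup>2 * S.expectation (\<lambda>s. (f2 s wc i)\<^sup>2)
      + \<gamma>\<^sup>2 * (f1 wc w1 i)\<^sup>2 + \<delta>\<^sup>2 * N + 2 * \<alpha> * \<beta> * S.expectation (\<lambda>s. s i * f2 s wc i)
      + 2 * \<beta> * \<gamma> * (f1 wc w1 i * S.expectation (\<lambda>s. f2 s wc i)))"
    unfolding quad_def by (intro avg_cong has_bochner_integral_integral_eq has_bochner_integral_lin_sq)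
  also have "\<dots> = \<alpha>\<^sup>2 * Q + \<beta>\<^sup>2 * ?p2 + \<gamma>\<^sup>2 * ?p1 + \<delta>\<^sup>2 * N + 2 * \<alpha> * \<beta> * ?c2s + 2 * \<beta> * \<gamma> * ?c12"
    unfolding avg_add avg_mult avg_const ..
  finally show "quad \<alpha> \<beta> \<gamma> \<delta> = \<dots>" .
qed

lemma quad_nonneg: "quad \<alpha> \<beta> \<gamma> \<delta> \<ge> 0"
  unfolding quad_def avg_def by (intro divide_nonneg_nonneg sum_nonneg integral_nonneg_AE) auto

lemma err_prob_eq:
  "err_prob Q N n Mc M1 f1 f2 dec = 1 - (\<Sum>wc<Mc. \<Sum>w1<M1. prob (correct wc w1)) / (real Mc * real M1)"
proof -
  have "measure SZ {sz \<in> space SZ. dec (chan_out n (f1 wc w1) (f2 (fst sz) wc) (fst sz) (snd sz)) \<noteq> (wc, w1)}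
    = 1 - prob (correct wc w1)" if "wc < Mc" for wc w1
  proof -
    have "{sz \<in> space SZ. dec (chan_out n (f1 wc w1) (f2 (fst sz) wc) (fst sz) (snd sz)) \<noteq> (wc, w1)}
      = space SZ - correct wc w1"
      unfolding correct_def by auto
    then show ?thesis using prob_compl[OF correct_event[OF that]] by simp
  qed
  then show ?thesis
    using Mc M1 unfolding err_prob_def by (simp add: sum_subtractf diff_divide_distrib)
qed

section \<open>Converse for the sum rate\<close>

text \<open>Under the alternative law Y is i.i.d. N(0, sY) and S given Y and the messages is N(a Y +
  b X1, sr). The bounds on \<open>quad\<close> make the averaged relative entropy at most
  \<open>real n / 2 * ln (sY * sr / (Q * N))\<close>; guessing adds \<open>ln 2\<close>. The
  coefficients \<open>a\<close> and \<open>b\<close> stay free for later tuning.\<close>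

lemma sum_rate_converse:
  assumes sY: "sY > 0" and sr: "sr > 0"
    and qY: "quad 1 1 1 1 \<le> sY" and qr: "quad (1 - a) (- a) (- a - b) (- a) \<le> sr"
  shows "(1 - err_prob Q N n Mc M1 f1 f2 dec) * ln (real Mc * real M1)
    \<le> real n / 2 * ln (sY * sr / (Q * N)) + ln 2"
proof -
  let ?J = "{..<Mc} \<times> {..<M1}"
  let ?Leb = "PiM {..<n} (\<lambda>_. lborel) :: (nat \<Rightarrow> real) measure"
  define c where "c = ln (real (card ?J))"
  define k where "k = ln (sY * sr / (Q * N)) / 2"
  \<comment> \<open>The squares come from the alternative densities of Y and of S given Y, then,
    with opposite sign, from the true densities of S and Z; \<open>k\<close> collects the
    normalising constants. Negative terms are written as \<open>+ - 1 / ...\<close> so that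
    \<open>avg_add\<close> and \<open>avg_mult\<close> apply.\<close>
  define l where "l w i sz = 1 / (2 * sY) * (lin 1 1 1 1 (fst w) (snd w) i sz)\<^sup>2
      + 1 / (2 * sr) * (lin (1 - a) (- a) (- a - b) (- a) (fst w) (snd w) i sz)\<^sup>2
      + - 1 / (2 * Q) * (lin 1 0 0 0 (fst w) (snd w) i sz)\<^sup>2
      + - 1 / (2 * N) * (lin 0 0 0 1 (fst w) (snd w) i sz)\<^sup>2 + k" for w i sz
  \<comment> \<open>The log-likelihood ratio of the true law of (S, Z) against the alternative one, given the messages w.\<close>
  define L where "L w sz = (\<Sum>i<n. l w i sz)" for w sz
  define A where "A w = correct (fst w) (snd w)" for w
  \<comment> \<open>The messages enter \<open>K\<close> only through correctness of the decision:
    the alternative density of Y is common to all of them.\<close>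
  define K where "K w y = exp (c * of_bool (dec y = w)) * (\<Prod>i<n. normal_density 0 (sqrt sY) (y i))" for w y
  have Leb_sets[measurable_cong]: "sets ?Leb = sets (PiM {..<n} (\<lambda>_. borel))"
    by (intro sets_PiM_cong) auto
  have l_int: "integrable SZ (l w i)" if "w \<in> ?J" "i < n" for w i
    unfolding l_def using that
    by (intro Bochner_Integration.integrable_add integrable_mult_right integrable_lin_sq) auto
  have L_int: "integrable SZ (L w)" if "w \<in> ?J" for w
    unfolding L_def using that l_int by auto

  have pt: "ennreal (exp (c * indicator (A w) sz - L w sz))
      = ennreal (K w y) * ennreal (\<Prod>i<n. normal_density (a * y i + b * f1 (fst w) (snd w) i) (sqrt sr) (fst sz i))
        * ennreal (\<Prod>i<n. 1 / normal_density 0 (sqrt Q) (fst sz i))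
        * ennreal (\<Prod>i<n. 1 / normal_density 0 (sqrt N) (snd sz i))"
    if y: "y = chan_out n (f1 (fst w) (snd w)) (f2 (fst sz) (fst w)) (fst sz) (snd sz)"
      and sz: "sz \<in> space SZ" for w sz y
  proof -
    have ind: "indicator (A w) sz = (of_bool (dec y = w) :: real)"
      using sz unfolding A_def correct_def y by (auto simp: indicator_def)
    have li: "exp (- l w i sz) = normal_density 0 (sqrt sY) (y i)
        * normal_density (a * y i + b * f1 (fst w) (snd w) i) (sqrt sr) (fst sz i)
        * (1 / normal_density 0 (sqrt Q) (fst sz i)) * (1 / normal_density 0 (sqrt N) (snd sz i))"
      if "i < n" for i
    proof -
      have yi: "y i = lin 1 1 1 1 (fst w) (snd w) i sz"
        using that unfolding y chan_out_def lin_def by simp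
      have ri: "fst sz i - (a * y i + b * f1 (fst w) (snd w) i)
          = lin (1 - a) (- a) (- a - b) (- a) (fst w) (snd w) i sz"
        unfolding yi lin_def by (simp add: algebra_simps)
      have s: "fst sz i = lin 1 0 0 0 (fst w) (snd w) i sz" and z: "snd sz i = lin 0 0 0 1 (fst w) (snd w) i sz"
        by (auto simp: lin_def)
      have kk: "2 * k = ln (2 * pi * sY) + ln (2 * pi * sr) - ln (2 * pi * Q) - ln (2 * pi * N)"
        unfolding k_def using sY sr Q N by (simp add: ln_mult ln_div)
      show ?thesis
        unfolding normal_density_eq_exp[OF sY] normal_density_eq_exp[OF sr] normal_density_eq_exp[OF Q]
          normal_density_eq_exp[OF N] ri
        unfolding l_def s[symmetric] z[symmetric] yi[symmetric] inverse_exp mult_exp_exp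
        using kk by (intro arg_cong[where f = exp]) simp
    qed
    have "exp (- L w sz) = (\<Prod>i<n. exp (- l w i sz))"
      unfolding L_def by (simp add: exp_sum sum_negf[symmetric])
    also have "\<dots> = (\<Prod>i<n. normal_density 0 (sqrt sY) (y i)
        * normal_density (a * y i + b * f1 (fst w) (snd w) i) (sqrt sr) (fst sz i)
        * (1 / normal_density 0 (sqrt Q) (fst sz i)) * (1 / normal_density 0 (sqrt N) (snd sz i)))"
      using li by (intro prod.cong) auto
    finally have eL: "exp (- L w sz) = \<dots>" .
    have "exp (c * indicator (A w) sz - L w sz) = exp (c * of_bool (dec y = w)) * exp (- L w sz)"
      unfolding ind mult_exp_exp by simp
    also have "\<dots> = K w y
       * (\<Prod>i<n. normal_density (a * y i + b * f1 (fst w) (snd w) i) (sqrt sr) (fst sz i))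
       * (\<Prod>i<n. 1 / normal_density 0 (sqrt Q) (fst sz i)) * (\<Prod>i<n. 1 / normal_density 0 (sqrt N) (snd sz i))"
      unfolding eL prod.distrib K_def by (simp only: mult.assoc)
    finally show ?thesis
      by (simp add: ennreal_mult prod_nonneg K_def)
  qed

  \<comment> \<open>For fixed s the noise integral becomes a Lebesgue integral over y, which absorbs
    the encoder \<open>f2\<close>. After exchanging the integrals, the alternative density of S
    given y integrates to 1, and S is gone.\<close>
  have B: "(\<integral>\<^sup>+sz. ennreal (exp (c * indicator (A w) sz - L w sz)) \<partial>SZ) = (\<integral>\<^sup>+y. ennreal (K w y) \<partial>?Leb)"
    if w: "w \<in> ?J" for w
  proof -
    interpret prd: product_sigma_finite "\<lambda>_::nat. lborel :: real measure"
      by (rule product_sigma_finite_lborel)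
    interpret Leb: sigma_finite_measure ?Leb by (rule prd.sigma_finite) simp
    interpret SL: pair_sigma_finite ?Leb "iid_gauss Q n" ..
    have wM: "fst w < Mc" using w by auto
    define x1 where "x1 = f1 (fst w) (snd w)"
    define G where "G s y = ennreal (K w y)
        * ennreal (\<Prod>i<n. normal_density (a * y i + b * x1 i) (sqrt sr) (s i))
        * ennreal (\<Prod>i<n. 1 / normal_density 0 (sqrt Q) (s i))" for s y
    define h where "h s i = x1 i + f2 s (fst w) i + s i" for s i
    have K_meas[measurable]: "K w \<in> borel_measurable (PiM {..<n} (\<lambda>_. borel))"
      unfolding K_def by measurable
    have G_meas: "(\<lambda>(y, s). G s y) \<in> borel_measurable (PiM {..<n} (\<lambda>_. borel) \<Otimes>\<^sub>M PiM {..<n} (\<lambda>_. borel))"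
      unfolding G_def by measurable
    have Gs_meas: "G s \<in> borel_measurable (PiM {..<n} (\<lambda>_. borel))" for s
      unfolding G_def by measurable
    have meas: "(\<lambda>sz. ennreal (exp (c * indicator (A w) sz - L w sz))) \<in> borel_measurable SZ"
      using borel_measurable_integrable[OF L_int[OF w]] correct_event[OF wM, of "snd w"]
      unfolding A_def by measurable
    have "(\<integral>\<^sup>+sz. ennreal (exp (c * indicator (A w) sz - L w sz)) \<partial>SZ)
      = (\<integral>\<^sup>+s. \<integral>\<^sup>+z. ennreal (exp (c * indicator (A w) (s, z) - L w (s, z))) \<partial>iid_gauss N n \<partial>iid_gauss Q n)"
      using Z.nn_integral_fst[OF meas] by simp
    also have "\<dots> = (\<integral>\<^sup>+s. \<integral>\<^sup>+z. G s (\<lambda>i\<in>{..<n}. h s i + z i)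
        * ennreal (\<Prod>i<n. 1 / normal_density 0 (sqrt N) (z i)) \<partial>iid_gauss N n \<partial>iid_gauss Q n)"
    proof (intro nn_integral_cong)
      fix s z assume "s \<in> space (iid_gauss Q n)" "z \<in> space (iid_gauss N n)"
      then have "(s, z) \<in> space SZ" by (simp add: space_pair_measure)
      moreover have "(\<lambda>i\<in>{..<n}. h s i + z i) = chan_out n x1 (f2 s (fst w)) s z"
        unfolding chan_out_def h_def ..
      ultimately show "ennreal (exp (c * indicator (A w) (s, z) - L w (s, z)))
        = G s (\<lambda>i\<in>{..<n}. h s i + z i) * ennreal (\<Prod>i<n. 1 / normal_density 0 (sqrt N) (z i))"
        using pt[of "\<lambda>i\<in>{..<n}. h s i + z i" w "(s, z)"] unfolding G_def x1_def by simp
    qed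
    also have "\<dots> = (\<integral>\<^sup>+s. \<integral>\<^sup>+y. G s y \<partial>?Leb \<partial>iid_gauss Q n)"
      by (intro nn_integral_cong nn_integral_iid_gauss_translate N Gs_meas)
    also have "\<dots> = (\<integral>\<^sup>+y. \<integral>\<^sup>+s. G s y \<partial>iid_gauss Q n \<partial>?Leb)"
      by (rule SL.Fubini') (use G_meas in measurable)
    also have "\<dots> = (\<integral>\<^sup>+y. ennreal (K w y) \<partial>?Leb)"
    proof (rule nn_integral_cong)
      fix y :: "nat \<Rightarrow> real"
      define R where "R s = ennreal (\<Prod>i<n. normal_density (a * y i + b * x1 i) (sqrt sr) (s i))" for s
      have R_meas[measurable]: "R \<in> borel_measurable (PiM {..<n} (\<lambda>_. borel))"
        unfolding R_def by measurable
      have "(\<integral>\<^sup>+s. G s y \<partial>iid_gauss Q n)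
        = (\<integral>\<^sup>+s. ennreal (K w y) * (R s * ennreal (\<Prod>i<n. 1 / normal_density 0 (sqrt Q) (s i))) \<partial>iid_gauss Q n)"
        unfolding G_def R_def by (simp add: mult.assoc)
      also have "\<dots> = ennreal (K w y) * (\<integral>\<^sup>+s. R s * ennreal (\<Prod>i<n. 1 / normal_density 0 (sqrt Q) (s i)) \<partial>iid_gauss Q n)"
        by (rule nn_integral_cmult) measurable
      \<comment> \<open>The translation lemma is used with shift 0 to strip off the true law of
        S.\<close>
      also have "(\<integral>\<^sup>+s. R s * ennreal (\<Prod>i<n. 1 / normal_density 0 (sqrt Q) (s i)) \<partial>iid_gauss Q n)
        = (\<integral>\<^sup>+s. R (\<lambda>i\<in>{..<n}. 0 + s i) * ennreal (\<Prod>i<n. 1 / normal_density 0 (sqrt Q) (s i)) \<partial>iid_gauss Q n)"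
        by (intro nn_integral_cong) (simp add: R_def)
      also have "\<dots> = (\<integral>\<^sup>+s. R s \<partial>?Leb)"
        by (rule nn_integral_iid_gauss_translate[OF Q]) measurable
      also have "\<dots> = 1"
        unfolding R_def using sr by (intro nn_integral_PiM_normal_density) simp
      finally show "(\<integral>\<^sup>+s. G s y \<partial>iid_gauss Q n) = ennreal (K w y)" by simp
    qed
    finally show ?thesis .
  qed

  have "(\<Sum>w\<in>?J. \<integral>\<^sup>+sz. ennreal (exp (c * indicator (A w) sz - L w sz)) \<partial>SZ)
    = (\<Sum>w\<in>?J. \<integral>\<^sup>+y. ennreal (K w y) \<partial>?Leb)"
    by (intro sum.cong refl B)
  also have "\<dots> = (\<integral>\<^sup>+y. (\<Sum>w\<in>?J. ennreal (K w y)) \<partial>?Leb)"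
    unfolding K_def by (intro nn_integral_sum[symmetric]) measurable
  \<comment> \<open>At each y the weights sum to at most twice the number of message pairs, since
    the decision matches at most one of them.\<close>
  also have "\<dots> \<le> (\<integral>\<^sup>+y. ennreal (2 * real (card ?J)) * ennreal (\<Prod>i<n. normal_density 0 (sqrt sY) (y i)) \<partial>?Leb)"
  proof (rule nn_integral_mono)
    fix y :: "nat \<Rightarrow> real"
    have "(\<Sum>w\<in>?J. K w y) \<le> 2 * real (card ?J) * (\<Prod>i<n. normal_density 0 (sqrt sY) (y i))"
      unfolding K_def c_def sum_distrib_right[symmetric] using Mc M1
      by (intro mult_right_mono sum_exp_indicator_le prod_nonneg) auto
    then show "(\<Sum>w\<in>?J. ennreal (K w y))
        \<le> ennreal (2 * real (card ?J)) * ennreal (\<Prod>i<n. normal_density 0 (sqrt sY) (y i))"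
      by (subst sum_ennreal) (auto simp: K_def prod_nonneg ennreal_mult[symmetric] intro!: ennreal_leI)
  qed
  also have "\<dots> = ennreal (2 * real (card ?J)) * (\<integral>\<^sup>+y. ennreal (\<Prod>i<n. normal_density 0 (sqrt sY) (y i)) \<partial>?Leb)"
    by (rule nn_integral_cmult) measurable
  also have "\<dots> = ennreal (2 * real (card ?J))"
    using nn_integral_PiM_normal_density[of "sqrt sY" n "\<lambda>_. 0"] sY by simp
  finally have "c * (\<Sum>w\<in>?J. prob (A w)) \<le> (\<Sum>w\<in>?J. expectation (L w)) + real (card ?J) * ln 2"
    using L_int correct_event
    by (intro sum_change_of_measure_bound) (auto simp: A_def)
  moreover have "(\<Sum>w\<in>?J. expectation (L w))
      = real Mc * real M1 * real n * (1 / (2 * sY) * quad 1 1 1 1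
        + 1 / (2 * sr) * quad (1 - a) (- a) (- a - b) (- a)
        + - 1 / (2 * Q) * quad 1 0 0 0 + - 1 / (2 * N) * quad 0 0 0 1 + k)"
  proof -
    have el: "expectation (l w i) = 1 / (2 * sY) * expectation (\<lambda>sz. (lin 1 1 1 1 (fst w) (snd w) i sz)\<^sup>2)
      + 1 / (2 * sr) * expectation (\<lambda>sz. (lin (1 - a) (- a) (- a - b) (- a) (fst w) (snd w) i sz)\<^sup>2)
      + - 1 / (2 * Q) * expectation (\<lambda>sz. (lin 1 0 0 0 (fst w) (snd w) i sz)\<^sup>2)
      + - 1 / (2 * N) * expectation (\<lambda>sz. (lin 0 0 0 1 (fst w) (snd w) i sz)\<^sup>2) + k"
      if "w \<in> ?J" "i < n" for w i
      unfolding l_def using that integrable_lin_sq by (auto simp: prob_space)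
    have "(\<Sum>w\<in>?J. expectation (L w)) = (\<Sum>wc<Mc. \<Sum>w1<M1. \<Sum>i<n. expectation (l (wc, w1) i))"
      unfolding L_def using l_int
      by (simp add: sum.cartesian_product'[where A = "{..<Mc}"] cong: sum.cong)
    also have "\<dots> = real Mc * real M1 * real n * avg (\<lambda>wc w1 i. expectation (l (wc, w1) i))"
      using Mc M1 n unfolding avg_def by simp
    also have "avg (\<lambda>wc w1 i. expectation (l (wc, w1) i))
      = avg (\<lambda>wc w1 i. 1 / (2 * sY) * expectation (\<lambda>sz. (lin 1 1 1 1 wc w1 i sz)\<^sup>2)
        + 1 / (2 * sr) * expectation (\<lambda>sz. (lin (1 - a) (- a) (- a - b) (- a) wc w1 i sz)\<^sup>2)
        + - 1 / (2 * Q) * expectation (\<lambda>sz. (lin 1 0 0 0 wc w1 i sz)\<^sup>2)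
        + - 1 / (2 * N) * expectation (\<lambda>sz. (lin 0 0 0 1 wc w1 i sz)\<^sup>2) + k)"
      by (intro avg_cong) (subst el, auto)
    also have "\<dots> = 1 / (2 * sY) * quad 1 1 1 1 + 1 / (2 * sr) * quad (1 - a) (- a) (- a - b) (- a)
        + - 1 / (2 * Q) * quad 1 0 0 0 + - 1 / (2 * N) * quad 0 0 0 1 + k"
      unfolding avg_add avg_mult avg_const quad_def ..
    finally show ?thesis .
  qed
  moreover have "real Mc * real M1 * real n * (1 / (2 * sY) * quad 1 1 1 1
        + 1 / (2 * sr) * quad (1 - a) (- a) (- a - b) (- a)
        + - 1 / (2 * Q) * quad 1 0 0 0 + - 1 / (2 * N) * quad 0 0 0 1 + k) \<le> real Mc * real M1 * real n * k"
  proof (rule mult_left_mono)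
    have qS: "quad 1 0 0 0 = Q" and qZ: "quad 0 0 0 1 = N"
      by (rule quad_eq; simp)+
    \<comment> \<open>The alternative densities contribute at most 1/2 each, the true ones exactly
      -1/2 each, so at most \<open>k\<close> survives.\<close>
    have "1 / (2 * sY) * quad 1 1 1 1 \<le> 1 / 2" "1 / (2 * sr) * quad (1 - a) (- a) (- a - b) (- a) \<le> 1 / 2"
      using qY qr sY sr by (auto simp: field_simps)
    moreover have "- 1 / (2 * Q) * quad 1 0 0 0 = - 1 / 2" "- 1 / (2 * N) * quad 0 0 0 1 = - 1 / 2"
      using Q N unfolding qS qZ by auto
    ultimately show "1 / (2 * sY) * quad 1 1 1 1 + 1 / (2 * sr) * quad (1 - a) (- a) (- a - b) (- a)
        + - 1 / (2 * Q) * quad 1 0 0 0 + - 1 / (2 * N) * quad 0 0 0 1 + k \<le> k"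
      by linarith
  qed simp
  ultimately have "c * (\<Sum>w\<in>?J. prob (A w)) \<le> real Mc * real M1 * real n * k + real Mc * real M1 * ln 2"
    by (simp only: card_cartesian_product card_lessThan of_nat_mult)
  moreover have "(\<Sum>w\<in>?J. prob (A w)) = (1 - err_prob Q N n Mc M1 f1 f2 dec) * (real Mc * real M1)"
    using Mc M1 unfolding err_prob_eq A_def by (simp add: sum.cartesian_product')
  ultimately have "(real Mc * real M1) * ((1 - err_prob Q N n Mc M1 f1 f2 dec) * ln (real Mc * real M1))
      \<le> (real Mc * real M1) * (real n / 2 * ln (sY * sr / (Q * N)) + ln 2)"
    unfolding c_def k_def by (simp add: card_cartesian_product algebra_simps)
  then show ?thesis
    by (rule mult_left_le_imp_le) (use Mc M1 in simp)
qed

section \<open>Converse for the individual rate\<close>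

text \<open>Given the state and the common message, the alternative law makes Y Gaussian with a mean
  that ignores \<open>w1\<close> and with variance \<open>s1\<close>; the state keeps its true law.
  Y minus that mean is X1 + Z - \<beta> X2 - \<gamma> S, whose averaged second moment is what
  \<open>q1\<close> bounds.\<close>

lemma individual_rate_converse:
  assumes s1: "s1 > 0" and q1: "quad (- \<gamma>) (- \<beta>) 1 1 \<le> s1"
  shows "(1 - err_prob Q N n Mc M1 f1 f2 dec) * ln (real M1) \<le> real n / 2 * ln (s1 / N) + ln 2"
proof -
  let ?Leb = "PiM {..<n} (\<lambda>_. lborel) :: (nat \<Rightarrow> real) measure"
  define c where "c = ln (real M1)"
  define k where "k = ln (s1 / N) / 2"
  define l where "l wc w1 i sz = 1 / (2 * s1) * (lin (- \<gamma>) (- \<beta>) 1 1 wc w1 i sz)\<^sup>2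
      + - 1 / (2 * N) * (lin 0 0 0 1 wc w1 i sz)\<^sup>2 + k" for wc w1 i sz
  define L where "L wc w1 sz = (\<Sum>i<n. l wc w1 i sz)" for wc w1 sz
  \<comment> \<open>X2 + S is known from the state and the common message; the last two summands
    estimate X1 from them.\<close>
  define m where "m wc s i = f2 s wc i + s i + \<beta> * f2 s wc i + \<gamma> * s i" for wc and s :: "nat \<Rightarrow> real" and i
  define K where "K wc s w1 y = exp (c * of_bool (dec y = (wc, w1)))
      * (\<Prod>i<n. normal_density (m wc s i) (sqrt s1) (y i))" for wc s w1 y
  have Leb_sets[measurable_cong]: "sets ?Leb = sets (PiM {..<n} (\<lambda>_. borel))"
    by (intro sets_PiM_cong) auto
  have l_int: "integrable SZ (l wc w1 i)" if "wc < Mc" "i < n" for wc w1 i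
    unfolding l_def using that
    by (intro Bochner_Integration.integrable_add integrable_mult_right integrable_lin_sq) auto
  have L_int: "integrable SZ (L wc w1)" if "wc < Mc" for wc w1
    unfolding L_def using that l_int by auto

  have pt: "ennreal (exp (c * indicator (correct wc w1) sz - L wc w1 sz))
      = ennreal (K wc (fst sz) w1 y) * ennreal (\<Prod>i<n. 1 / normal_density 0 (sqrt N) (snd sz i))"
    if y: "y = chan_out n (f1 wc w1) (f2 (fst sz) wc) (fst sz) (snd sz)"
      and sz: "sz \<in> space SZ" for wc w1 sz y
  proof -
    have ind: "indicator (correct wc w1) sz = (of_bool (dec y = (wc, w1)) :: real)"
      using sz unfolding correct_def y by (auto simp: indicator_def)
    have li: "exp (- l wc w1 i sz) = normal_density (m wc (fst sz) i) (sqrt s1) (y i)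
        * (1 / normal_density 0 (sqrt N) (snd sz i))" if "i < n" for i
    proof -
      have yi: "y i - m wc (fst sz) i = lin (- \<gamma>) (- \<beta>) 1 1 wc w1 i sz"
        using that unfolding y chan_out_def lin_def m_def by simp
      have z: "snd sz i = lin 0 0 0 1 wc w1 i sz"
        by (auto simp: lin_def)
      have kk: "2 * k = ln (2 * pi * s1) - ln (2 * pi * N)"
        unfolding k_def using s1 N by (simp add: ln_mult ln_div)
      show ?thesis
        unfolding normal_density_eq_exp[OF s1] normal_density_eq_exp[OF N] yi
        unfolding l_def z[symmetric] inverse_exp mult_exp_exp
        using kk by (intro arg_cong[where f = exp]) simp
    qed
    have "exp (- L wc w1 sz) = (\<Prod>i<n. exp (- l wc w1 i sz))"
      unfolding L_def by (simp add: exp_sum sum_negf[symmetric])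
    also have "\<dots> = (\<Prod>i<n. normal_density (m wc (fst sz) i) (sqrt s1) (y i)
        * (1 / normal_density 0 (sqrt N) (snd sz i)))"
      using li by (intro prod.cong) auto
    finally have eL: "exp (- L wc w1 sz) = \<dots>" .
    have "exp (c * indicator (correct wc w1) sz - L wc w1 sz)
      = exp (c * of_bool (dec y = (wc, w1))) * exp (- L wc w1 sz)"
      unfolding ind mult_exp_exp by simp
    also have "\<dots> = K wc (fst sz) w1 y * (\<Prod>i<n. 1 / normal_density 0 (sqrt N) (snd sz i))"
      unfolding eL prod.distrib K_def by (simp only: mult.assoc)
    finally show ?thesis
      by (simp add: ennreal_mult prod_nonneg K_def)
  qed

  have K_meas[measurable]: "K wc s w1 \<in> borel_measurable (PiM {..<n} (\<lambda>_. borel))" for wc s w1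
    unfolding K_def by measurable
  \<comment> \<open>The common message stays fixed because the mean \<open>m\<close> depends on it;
    guessing is among \<open>M1\<close> messages only. Averaging over \<open>wc\<close>
    follows.\<close>
  have per_wc: "c * (\<Sum>w1<M1. prob (correct wc w1)) \<le> (\<Sum>w1<M1. expectation (L wc w1)) + real M1 * ln 2"
    if wc: "wc < Mc" for wc
  proof -
    define F where "F w1 sz = ennreal (exp (c * indicator (correct wc w1) sz - L wc w1 sz))" for w1 sz
    have F_meas: "F w1 \<in> borel_measurable SZ" for w1
      using borel_measurable_integrable[OF L_int[OF wc]] correct_event[OF wc]
      unfolding F_def by measurable
    have inner: "(\<integral>\<^sup>+z. F w1 (s, z) \<partial>iid_gauss N n) = (\<integral>\<^sup>+y. ennreal (K wc s w1 y) \<partial>?Leb)"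
      if s: "s \<in> space (iid_gauss Q n)" for w1 s
    proof -
      define h where "h i = f1 wc w1 i + f2 s wc i + s i" for i
      have "(\<integral>\<^sup>+z. F w1 (s, z) \<partial>iid_gauss N n)
        = (\<integral>\<^sup>+z. ennreal (K wc s w1 (\<lambda>i\<in>{..<n}. h i + z i))
            * ennreal (\<Prod>i<n. 1 / normal_density 0 (sqrt N) (z i)) \<partial>iid_gauss N n)"
      proof (intro nn_integral_cong)
        fix z assume "z \<in> space (iid_gauss N n)"
        then have "(s, z) \<in> space SZ" using s by (simp add: space_pair_measure)
        moreover have "(\<lambda>i\<in>{..<n}. h i + z i) = chan_out n (f1 wc w1) (f2 s wc) s z"
          unfolding chan_out_def h_def ..
        ultimately show "F w1 (s, z) = ennreal (K wc s w1 (\<lambda>i\<in>{..<n}. h i + z i))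
            * ennreal (\<Prod>i<n. 1 / normal_density 0 (sqrt N) (z i))"
          using pt[of "\<lambda>i\<in>{..<n}. h i + z i" wc w1 "(s, z)"] unfolding F_def by simp
      qed
      also have "\<dots> = (\<integral>\<^sup>+y. ennreal (K wc s w1 y) \<partial>?Leb)"
        by (intro nn_integral_iid_gauss_translate N) measurable
      finally show ?thesis .
    qed
    have "(\<Sum>w1<M1. \<integral>\<^sup>+sz. F w1 sz \<partial>SZ) = (\<Sum>w1<M1. \<integral>\<^sup>+s. \<integral>\<^sup>+z. F w1 (s, z) \<partial>iid_gauss N n \<partial>iid_gauss Q n)"
      using Z.nn_integral_fst[OF F_meas] by simp
    also have "\<dots> = (\<integral>\<^sup>+s. (\<Sum>w1<M1. \<integral>\<^sup>+z. F w1 (s, z) \<partial>iid_gauss N n) \<partial>iid_gauss Q n)"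
      by (intro nn_integral_sum[symmetric] Z.borel_measurable_nn_integral_fst F_meas)
    also have "\<dots> \<le> (\<integral>\<^sup>+s. ennreal (2 * real M1) \<partial>iid_gauss Q n)"
    proof (rule nn_integral_mono)
      fix s assume s: "s \<in> space (iid_gauss Q n)"
      have "(\<Sum>w1<M1. \<integral>\<^sup>+z. F w1 (s, z) \<partial>iid_gauss N n) = (\<Sum>w1<M1. \<integral>\<^sup>+y. ennreal (K wc s w1 y) \<partial>?Leb)"
        by (simp add: inner[OF s])
      also have "\<dots> = (\<integral>\<^sup>+y. (\<Sum>w1<M1. ennreal (K wc s w1 y)) \<partial>?Leb)"
        by (intro nn_integral_sum[symmetric]) measurable
      also have "\<dots> \<le> (\<integral>\<^sup>+y. ennreal (2 * real M1)
          * ennreal (\<Prod>i<n. normal_density (m wc s i) (sqrt s1) (y i)) \<partial>?Leb)"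
      proof (rule nn_integral_mono)
        fix y :: "nat \<Rightarrow> real"
        \<comment> \<open>A correct pair has a correct individual component, and
          \<open>c \<ge> 0\<close>.\<close>
        have "(\<Sum>w1<M1. exp (c * of_bool (dec y = (wc, w1)))) \<le> (\<Sum>w1<M1. exp (c * of_bool (snd (dec y) = w1)))"
          using M1 unfolding c_def by (intro sum_mono) auto
        also have "\<dots> \<le> 2 * real M1"
          using sum_exp_indicator_le[of "{..<M1}" "snd (dec y)"] M1 unfolding c_def by auto
        finally have "(\<Sum>w1<M1. K wc s w1 y) \<le> 2 * real M1 * (\<Prod>i<n. normal_density (m wc s i) (sqrt s1) (y i))"
          unfolding K_def sum_distrib_right[symmetric]
          by (intro mult_right_mono prod_nonneg) auto
        then show "(\<Sum>w1<M1. ennreal (K wc s w1 y))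
            \<le> ennreal (2 * real M1) * ennreal (\<Prod>i<n. normal_density (m wc s i) (sqrt s1) (y i))"
          by (subst sum_ennreal) (auto simp: K_def prod_nonneg ennreal_mult[symmetric] intro!: ennreal_leI)
      qed
      also have "\<dots> = ennreal (2 * real M1)
          * (\<integral>\<^sup>+y. ennreal (\<Prod>i<n. normal_density (m wc s i) (sqrt s1) (y i)) \<partial>?Leb)"
        by (rule nn_integral_cmult) measurable
      also have "\<dots> = ennreal (2 * real M1)"
        using nn_integral_PiM_normal_density[of "sqrt s1" n "m wc s"] s1 by simp
      finally show "(\<Sum>w1<M1. \<integral>\<^sup>+z. F w1 (s, z) \<partial>iid_gauss N n) \<le> ennreal (2 * real M1)" .
    qed
    also have "\<dots> = ennreal (2 * real M1)"
      by (simp add: S.emeasure_space_1)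
    finally show ?thesis
      using sum_change_of_measure_bound[of "{..<M1}" "correct wc" "L wc" c] L_int[OF wc] correct_event[OF wc]
      unfolding F_def by simp
  qed
  have "c * (\<Sum>wc<Mc. \<Sum>w1<M1. prob (correct wc w1))
      \<le> (\<Sum>wc<Mc. (\<Sum>w1<M1. expectation (L wc w1)) + real M1 * ln 2)"
    by (subst sum_distrib_left) (intro sum_mono per_wc, auto)
  also have "\<dots> = (\<Sum>wc<Mc. \<Sum>w1<M1. \<Sum>i<n. expectation (l wc w1 i)) + real Mc * real M1 * ln 2"
    unfolding L_def using l_int by (simp add: sum.distrib)
  also have "(\<Sum>wc<Mc. \<Sum>w1<M1. \<Sum>i<n. expectation (l wc w1 i))
      = real Mc * real M1 * real n * avg (\<lambda>wc w1 i. expectation (l wc w1 i))"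
    using Mc M1 n unfolding avg_def by simp
  also have "avg (\<lambda>wc w1 i. expectation (l wc w1 i))
      = avg (\<lambda>wc w1 i. 1 / (2 * s1) * expectation (\<lambda>sz. (lin (- \<gamma>) (- \<beta>) 1 1 wc w1 i sz)\<^sup>2)
        + - 1 / (2 * N) * expectation (\<lambda>sz. (lin 0 0 0 1 wc w1 i sz)\<^sup>2) + k)"
    unfolding l_def using integrable_lin_sq by (intro avg_cong) (auto simp: prob_space)
  also have "\<dots> = 1 / (2 * s1) * quad (- \<gamma>) (- \<beta>) 1 1 + - 1 / (2 * N) * quad 0 0 0 1 + k"
    unfolding avg_add avg_mult avg_const quad_def ..
  also have "real Mc * real M1 * real n * (1 / (2 * s1) * quad (- \<gamma>) (- \<beta>) 1 1 + - 1 / (2 * N) * quad 0 0 0 1 + k)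
      \<le> real Mc * real M1 * real n * k"
  proof (rule mult_left_mono)
    have qZ: "quad 0 0 0 1 = N"
      by (rule quad_eq) simp
    have "1 / (2 * s1) * quad (- \<gamma>) (- \<beta>) 1 1 \<le> 1 / 2"
      using q1 s1 by (auto simp: field_simps)
    moreover have "- 1 / (2 * N) * quad 0 0 0 1 = - 1 / 2"
      using N unfolding qZ by auto
    ultimately show "1 / (2 * s1) * quad (- \<gamma>) (- \<beta>) 1 1 + - 1 / (2 * N) * quad 0 0 0 1 + k \<le> k"
      by linarith
  qed simp
  also have "(\<Sum>wc<Mc. \<Sum>w1<M1. prob (correct wc w1)) = (1 - err_prob Q N n Mc M1 f1 f2 dec) * (real Mc * real M1)"
    using Mc M1 unfolding err_prob_eq by simp
  finally have "(real Mc * real M1) * ((1 - err_prob Q N n Mc M1 f1 f2 dec) * ln (real M1))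
      \<le> (real Mc * real M1) * (real n / 2 * ln (s1 / N) + ln 2)"
    unfolding c_def k_def by (simp add: algebra_simps)
  then show ?thesis
    by (rule mult_left_le_imp_le) (use Mc M1 in simp)
qed

section \<open>From the converse bounds to the region\<close>

text \<open>The slack \<open>ln 2\<close> of either converse is 1/n in bits per symbol. Subtracting
  it from the individual rate alone corrects both the bound on R1 and the bound on the sum.\<close>

lemma rates_in_outer_region:
  assumes P1: "P1 \<ge> 0" and P2: "P2 \<ge> 0"
    and Rc: "2 powr (real n * Rc) \<le> real Mc" and R1: "2 powr (real n * R1) \<le> real M1"
  shows "((1 - err_prob Q N n Mc M1 f1 f2 dec) * Rc, (1 - err_prob Q N n Mc M1 f1 f2 dec) * R1 - 1 / real n)
    \<in> outer_region Q N P1 P2"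
proof -
  let ?s = "1 - err_prob Q N n Mc M1 f1 f2 dec"
  have s0: "?s \<ge> 0" unfolding err_prob_eq by (simp add: sum_nonneg)
  have ln1: "real n * R1 * ln 2 \<le> ln (real M1)"
    using ln_mono[OF R1] M1 by (simp add: ln_powr)
  have "real n * Rc * ln 2 \<le> ln (real Mc)"
    using ln_mono[OF Rc] Mc by (simp add: ln_powr)
  then have ln2: "real n * (Rc + R1) * ln 2 \<le> ln (real Mc * real M1)"
    using ln1 Mc M1 by (simp add: ln_mult algebra_simps)
  have to_log: "?s * R - 1 / real n \<le> 1/2 * log 2 x"
    if "real n * R * ln 2 \<le> m" "?s * m \<le> real n / 2 * ln x + ln 2" for R m x
  proof -
    have "?s * (real n * R * ln 2) \<le> real n / 2 * ln x + ln 2"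
      using mult_left_mono[OF that(1) s0] that(2) by linarith
    then show ?thesis using n by (simp add: log_def field_simps)
  qed
  obtain p1 p2 c12 c2s where p: "p1 \<le> P1" "p2 \<le> P2"
    and q: "\<And>\<alpha> \<beta> \<gamma> \<delta>. quad \<alpha> \<beta> \<gamma> \<delta>
       = \<alpha>\<^sup>2 * Q + \<beta>\<^sup>2 * p2 + \<gamma>\<^sup>2 * p1 + \<delta>\<^sup>2 * N + 2 * \<alpha> * \<beta> * c2s + 2 * \<beta> * \<gamma> * c12"
    by (rule quad_eq) blast
  \<comment> \<open>The coefficients are fitted to this code, and the same \<open>r12\<close> and
    \<open>r2s\<close> come with both bounds, as membership in a union over parameters
    demands.\<close>
  obtain r12 r2s a b \<beta> \<gamma> sY sr s1 where r: "r12 \<in> {0..1}" "r2s \<in> {-1..0}" "r12\<^sup>2 + r2s\<^sup>2 \<le> 1"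
    and pos: "sY > 0" "sr > 0" "s1 > 0"
    and quads: "quad 1 1 1 1 \<le> sY" "quad (1 - a) (- a) (- a - b) (- a) \<le> sr" "quad (- \<gamma>) (- \<beta>) 1 1 \<le> s1"
    and b1: "s1 / N \<le> 1 + P1 * ratio_term r12 r2s / N"
    and b2: "sY * sr / (Q * N) \<le> (1 + (sqrt P1 + r12 * sqrt P2)\<^sup>2 /
         (P2 * (1 - r12\<^sup>2 - r2s\<^sup>2) + (sqrt Q + r2s * sqrt P2)\<^sup>2 + N)) * (1 + P2 * (1 - r12\<^sup>2 - r2s\<^sup>2) / N)"
      (is "_ \<le> ?X * ?Y")
    by (rule optimal_parameters[OF Q N P1 P2 p q quad_nonneg]) blast
  have "?s * R1 - 1 / real n \<le> 1/2 * log 2 (s1 / N)"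
    by (rule to_log[OF ln1 individual_rate_converse[OF pos(3) quads(3)]])
  also have "\<dots> \<le> 1/2 * log 2 (1 + P1 * ratio_term r12 r2s / N)"
    using b1 pos N by (intro mult_left_mono log_mono) auto
  finally have le1: "?s * R1 - 1 / real n \<le> 1/2 * log 2 (1 + P1 * ratio_term r12 r2s / N)" .
  have v0: "P2 * (1 - r12\<^sup>2 - r2s\<^sup>2) \<ge> 0" using r P2 by simp
  have X: "?X > 0"
    using v0 N by (intro add_pos_nonneg divide_nonneg_nonneg add_nonneg_nonneg) auto
  have Y: "?Y > 0"
    using v0 N by (intro add_pos_nonneg divide_nonneg_nonneg) auto
  have "?s * (Rc + R1) - 1 / real n \<le> 1/2 * log 2 (sY * sr / (Q * N))"
    by (rule to_log[OF ln2 sum_rate_converse[OF pos(1,2) quads(1,2)]])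
  also have "\<dots> \<le> 1/2 * log 2 (?X * ?Y)"
    using b2 pos Q N by (intro mult_left_mono log_mono) auto
  also have "\<dots> = 1/2 * log 2 ?X + 1/2 * log 2 ?Y"
    unfolding log_mult_pos[OF X Y] by (simp add: distrib_left)
  finally have le2: "?s * Rc + (?s * R1 - 1 / real n) \<le> 1/2 * log 2 ?X + 1/2 * log 2 ?Y"
    by (simp add: distrib_left)
  show ?thesis
    unfolding outer_region_def
    by (rule UN_I[OF r(1)], rule UN_I[OF r(2)], subst if_P[OF r(3)])
      (simp only: mem_Collect_eq case_prod_conv le1 le2 simp_thms)
qed

end

theorem theorem4:
  fixes Q N P1 P2 :: real
  assumes "Q > 0" and "N > 0" and "P1 \<ge> 0" and "P2 \<ge> 0"
  shows "capacity_region Q N P1 P2 \<subseteq> outer_region Q N P1 P2"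
  unfolding capacity_region_def
proof (rule closure_minimal)
  show cl: "closed (outer_region Q N P1 P2)"
    using assms by (intro closed_outer_region)
  show "{r. achievable Q N P1 P2 r} \<subseteq> outer_region Q N P1 P2"
  proof
    fix r assume "r \<in> {r. achievable Q N P1 P2 r}"
    then obtain Mc M1 f1 f2 dec where
      c: "\<And>n. 2 powr (real n * fst r) \<le> real (Mc n)" "\<And>n. 2 powr (real n * snd r) \<le> real (M1 n)"
        "\<And>n. is_code Q P1 P2 n (Mc n) (M1 n) (f1 n) (f2 n) (dec n)"
      and err: "(\<lambda>n. err_prob Q N n (Mc n) (M1 n) (f1 n) (f2 n) (dec n)) \<longlonglongrightarrow> 0"
      unfolding achievable_def by blast
    define e where "e n = err_prob Q N n (Mc n) (M1 n) (f1 n) (f2 n) (dec n)" for n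
    \<comment> \<open>The shift to \<open>Suc n\<close> excludes block length 0; the message sets
      are nonempty because powers of 2 are positive.\<close>
    have "((1 - e (Suc n)) * fst r, (1 - e (Suc n)) * snd r - 1 / real (Suc n)) \<in> outer_region Q N P1 P2" for n
    proof -
      have "0 < real (Mc (Suc n))" "0 < real (M1 (Suc n))"
        using c(1,2)[of "Suc n"] by (smt (verit) powr_gt_zero)+
      then interpret gauss_mac_code Q N P1 P2 "Suc n" "Mc (Suc n)" "M1 (Suc n)" "f1 (Suc n)" "f2 (Suc n)" "dec (Suc n)"
        using assms c by unfold_locales auto
      show ?thesis
        unfolding e_def by (rule rates_in_outer_region[OF assms(3,4) c(1,2)])
    qed
    moreover have "(\<lambda>n. ((1 - e (Suc n)) * fst r, (1 - e (Suc n)) * snd r - 1 / real (Suc n)))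
        \<longlonglongrightarrow> ((1 - 0) * fst r, (1 - 0) * snd r - 0)"
      using err[folded e_def] lim_1_over_n[where 'a = real]
      by (intro tendsto_intros LIMSEQ_Suc)
    ultimately have "((1 - 0) * fst r, (1 - 0) * snd r - 0) \<in> outer_region Q N P1 P2"
      by (rule closed_sequentially[OF cl])
    then show "r \<in> outer_region Q N P1 P2" by simp
  qed
qed

end
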